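(* Let $G$ be an uncountable, locally finite group equipped with the coarse structure $\mathcal{E}_{fin}$ induced by the finitary bornology $\mathcal{B}_{fin}$. Then $G$ has exactly one coarse end.
   Context: A group is locally finite if each of its finitely generated subgroups is finite. For a group $G$, the finitary bornology $\mathcal{B}_{fin}$ is the family of all finite subsets of $G$. For $H\subseteq G$ put $E_H=\{(x,y)\in G\times G \mid x^{-1}y\in H\}$. The family $\{E_K\mid K\in\mathcal{B}_{fin}\}$ is a basis of a coarse structure $\mathcal{E}_{fin}$ on $G$: the entourages are the subsets of the sets $E_K$, $K$ finite. The bounded sets are exactly the finite subsets of $G$. Let $B(G,\mathbb{C})$ be the $C^*$-algebra of bounded functions $G\to\mathbb{C}$ with the supremum norm, and let $C_0(G,\mathbb{C})$ be the closed ideal of functions $f$ vanishing at infinity: for every $\varepsilon>0$ there is a finite $F\subseteq G$ with $|f(x)|<\varepsilon$ for all $x\notin F$. A function $f\in B(G,\mathbb{C})$ is a Higson function if for every entourage $E\in\mathcal{E}_{fin}$ and every $\varepsilon>0$ there is a finite $K\subseteq G$ such that $|f(x)-f(y)|<\varepsilon$ for all $(x,y)\in E$ with $x,y\notin K$. The Higson functions form a unital commutative $C^*$-algebra $C_h(G,\mathbb{C})$ containing $C_0(G,\mathbb{C})$ as a closed two-sided ideal. The Higson corona $\partial G$ is the compact Hausdorff maximal ideal space (Gelfand spectrum) of the unital commutative $C^*$-algebra $C_h(G,\mathbb{C})/C_0(G,\mathbb{C})$. The space of coarse ends of $G$ is the space $\pi_0(\partial G)$ of connected components of $\partial G$, and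 the number of coarse ends of $G$ is the cardinality of $\pi_0(\partial G)$. *)

theory Defs
  imports
    "HOL-Analysis.Analysis"
    "HOL-Algebra.Algebraic_Closure_Type"
    "HOL-Algebra.Generated_Groups"
    "HOL-Algebra.QuotRing"
    "HOL-Algebra.Module"
begin

section \<open>Locally finite groups and the finitary coarse structure\<close>

definition locally_finite_group :: "('a, 'm) monoid_scheme \<Rightarrow> bool" where
  "locally_finite_group G \<longleftrightarrow>
     (\<forall>A. A \<subseteq> carrier G \<and> finite A \<longrightarrow> finite (generate G A))"

definition finitary_bornology :: "('a, 'm) monoid_scheme \<Rightarrow> 'a set set" where
  "finitary_bornology G = {K. K \<subseteq> carrier G \<and> finite K}"

definition basic_entourage :: "('a, 'm) monoid_scheme \<Rightarrow> 'a set \<Rightarrow> ('a \<times> 'a) set" where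
  "basic_entourage G H =
     {(x, y). x \<in> carrier G \<and> y \<in> carrier G \<and> inv\<^bsub>G\<^esub> x \<otimes>\<^bsub>G\<^esub> y \<in> H}"

definition finitary_coarse_structure :: "('a, 'm) monoid_scheme \<Rightarrow> ('a \<times> 'a) set set" where
  "finitary_coarse_structure G =
     {E. \<exists>K \<in> finitary_bornology G. E \<subseteq> basic_entourage G K}"


section \<open>Higson functions and functions vanishing at infinity\<close>

text \<open>Functions on the group are represented by extensional functions on its carrier,
  so that functions agreeing on the carrier are equal.\<close>

definition bounded_functions :: "('a, 'm) monoid_scheme \<Rightarrow> ('a \<Rightarrow> complex) set" where
  "bounded_functions G = {f \<in> extensional (carrier G). bounded (f ` carrier G)}"

definition vanishing_functions :: "('a, 'm) monoid_scheme \<Rightarrow> ('a \<Rightarrow> complex) set" where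
  "vanishing_functions G = {f \<in> bounded_functions G.
     \<forall>\<epsilon>::real. \<epsilon> > 0 \<longrightarrow>
       (\<exists>F \<in> finitary_bornology G. \<forall>x \<in> carrier G - F. norm (f x) < \<epsilon>)}"

definition higson_functions :: "('a, 'm) monoid_scheme \<Rightarrow> ('a \<Rightarrow> complex) set" where
  "higson_functions G = {f \<in> bounded_functions G.
     \<forall>E \<in> finitary_coarse_structure G. \<forall>\<epsilon>::real. \<epsilon> > 0 \<longrightarrow>
       (\<exists>K \<in> finitary_bornology G.
          \<forall>(x, y) \<in> E. x \<notin> K \<and> y \<notin> K \<longrightarrow> norm (f x - f y) < \<epsilon>)}"

definition higson_algebra ::
  "('a, 'm) monoid_scheme \<Rightarrow> (complex, 'a \<Rightarrow> complex) module" where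
  "higson_algebra G =
     \<lparr>carrier = higson_functions G,
      mult = (\<lambda>f g. \<lambda>x\<in>carrier G. f x * g x),
      one = (\<lambda>x\<in>carrier G. 1),
      zero = (\<lambda>x\<in>carrier G. 0),
      add = (\<lambda>f g. \<lambda>x\<in>carrier G. f x + g x),
      smult = (\<lambda>c f. \<lambda>x\<in>carrier G. c * f x)\<rparr>"


section \<open>Quotient algebras and the Gelfand spectrum\<close>

text \<open>The quotient of an algebra by an ideal: the library's quotient ring, with the induced
  scalar multiplication \<open>c (I + x) = I + c x\<close>.\<close>

definition quotient_algebra ::
  "('c, 'b, 'm) module_scheme \<Rightarrow> 'b set \<Rightarrow> ('c, 'b set) module" where
  "quotient_algebra A I =
     ring.extend (A Quot I) (module.fields (\<lambda>c S. \<Union>x\<in>S. I +>\<^bsub>A\<^esub> (c \<odot>\<^bsub>A\<^esub> x)))"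

text \<open>Characters of a unital complex algebra. A multiplicative linear functional is nonzero iff
  it maps the unit to 1, which is part of \<open>ring_hom\<close>; on a C*-algebra such functionals are
  automatically continuous, so no norm is needed. If the algebra is zero there are none.\<close>

definition characters :: "(complex, 'b, 'm) module_scheme \<Rightarrow> ('b \<Rightarrow> complex) set" where
  "characters A = {\<phi> \<in> extensional (carrier A).
     \<phi> \<in> ring_hom A (ring_of_type_algebra :: complex ring) \<and>
     (\<forall>c. \<forall>x \<in> carrier A. \<phi> (c \<odot>\<^bsub>A\<^esub> x) = c * \<phi> x)}"

text \<open>The weak-* topology is the topology of pointwise convergence.\<close>

definition gelfand_spectrum :: "(complex, 'b, 'm) module_scheme \<Rightarrow> ('b \<Rightarrow> complex) topology" where
  "gelfand_spectrum A =
     subtopology (product_topology (\<lambda>_. euclidean) (carrier A)) (characters A)"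


section \<open>The Higson corona and coarse ends\<close>

definition higson_corona ::
  "('a, 'm) monoid_scheme \<Rightarrow> (('a \<Rightarrow> complex) set \<Rightarrow> complex) topology" where
  "higson_corona G =
     gelfand_spectrum (quotient_algebra (higson_algebra G) (vanishing_functions G))"

definition coarse_ends ::
  "('a, 'm) monoid_scheme \<Rightarrow> (('a \<Rightarrow> complex) set \<Rightarrow> complex) set set" where
  "coarse_ends G = connected_components_of (higson_corona G)"


section \<open>Well-definedness of the algebra, the ideal and the quotient\<close>

lemma bounded_functionsE:
  assumes "f \<in> bounded_functions G"
  obtains M where "M > 0" "\<And>x. x \<in> carrier G \<Longrightarrow> norm (f x) \<le> M"
  using assms unfolding bounded_functions_def bounded_pos by auto

lemma bounded_functionsI:
  assumes "f \<in> extensional (carrier G)" "\<And>x. x \<in> carrier G \<Longrightarrow> norm (f x) \<le> M"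
  shows "f \<in> bounded_functions G"
  using assms unfolding bounded_functions_def bounded_iff by auto

lemma finitary_entourage_subset:
  "E \<in> finitary_coarse_structure G \<Longrightarrow> E \<subseteq> carrier G \<times> carrier G"
  unfolding finitary_coarse_structure_def basic_entourage_def by auto

lemma finitary_bornology_Un:
  "K \<in> finitary_bornology G \<Longrightarrow> L \<in> finitary_bornology G \<Longrightarrow> K \<union> L \<in> finitary_bornology G"
  unfolding finitary_bornology_def by auto

lemma higson_functionsD:
  assumes "f \<in> higson_functions G" "E \<in> finitary_coarse_structure G" "\<epsilon> > 0"
  obtains K where "K \<in> finitary_bornology G"
    "\<And>x y. (x, y) \<in> E \<Longrightarrow> x \<notin> K \<Longrightarrow> y \<notin> K \<Longrightarrow> norm (f x - f y) < \<epsilon>"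
  using assms unfolding higson_functions_def by fastforce

lemma higson_functionsI:
  assumes "f \<in> bounded_functions G"
    and "\<And>E \<epsilon>::real. E \<in> finitary_coarse_structure G \<Longrightarrow> \<epsilon> > 0 \<Longrightarrow>
      \<exists>K \<in> finitary_bornology G. \<forall>x y. (x, y) \<in> E \<longrightarrow> x \<notin> K \<longrightarrow> y \<notin> K \<longrightarrow> norm (f x - f y) < \<epsilon>"
  shows "f \<in> higson_functions G"
  unfolding higson_functions_def
proof (intro CollectI conjI ballI allI impI)
  fix E and \<epsilon> :: real assume "E \<in> finitary_coarse_structure G" "\<epsilon> > 0"
  from assms(2)[OF this] show "\<exists>K \<in> finitary_bornology G.
      \<forall>(x, y) \<in> E. x \<notin> K \<and> y \<notin> K \<longrightarrow> norm (f x - f y) < \<epsilon>"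
    by blast
qed (rule assms(1))

lemma higson_bounded: "f \<in> higson_functions G \<Longrightarrow> f \<in> bounded_functions G"
  unfolding higson_functions_def by simp

lemma higson_extensional: "f \<in> higson_functions G \<Longrightarrow> f \<in> extensional (carrier G)"
  unfolding higson_functions_def bounded_functions_def by simp

lemma higson_const: "(\<lambda>x\<in>carrier G. c) \<in> higson_functions G"
proof (rule higson_functionsI)
  show "(\<lambda>x\<in>carrier G. c) \<in> bounded_functions G"
    by (rule bounded_functionsI[where M = "norm c"]) auto
next
  fix E and \<epsilon> :: real assume "E \<in> finitary_coarse_structure G" "\<epsilon> > 0"
  then show "\<exists>K \<in> finitary_bornology G. \<forall>x y. (x, y) \<in> E \<longrightarrow> x \<notin> K \<longrightarrow> y \<notin> K \<longrightarrow>
      norm ((\<lambda>x\<in>carrier G. c) x - (\<lambda>x\<in>carrier G. c) y) < \<epsilon>"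
    using finitary_entourage_subset[of E G]
    by (intro bexI[of _ "{}"]) (auto simp: finitary_bornology_def)
qed

lemma higson_add:
  assumes f: "f \<in> higson_functions G" and g: "g \<in> higson_functions G"
  shows "(\<lambda>x\<in>carrier G. f x + g x) \<in> higson_functions G"
proof (rule higson_functionsI)
  obtain M where M: "\<And>x. x \<in> carrier G \<Longrightarrow> norm (f x) \<le> M"
    using bounded_functionsE[OF higson_bounded[OF f]] by blast
  obtain N where N: "\<And>x. x \<in> carrier G \<Longrightarrow> norm (g x) \<le> N"
    using bounded_functionsE[OF higson_bounded[OF g]] by blast
  show "(\<lambda>x\<in>carrier G. f x + g x) \<in> bounded_functions G"
    by (rule bounded_functionsI[where M = "M + N"]) (auto intro: norm_triangle_mono M N)
next
  fix E and \<epsilon> :: real assume E: "E \<in> finitary_coarse_structure G" and e: "\<epsilon> > 0"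
  obtain K where K: "K \<in> finitary_bornology G"
    "\<And>x y. (x, y) \<in> E \<Longrightarrow> x \<notin> K \<Longrightarrow> y \<notin> K \<Longrightarrow> norm (f x - f y) < \<epsilon> / 2"
    using higson_functionsD[OF f E, of "\<epsilon> / 2"] e by auto
  obtain L where L: "L \<in> finitary_bornology G"
    "\<And>x y. (x, y) \<in> E \<Longrightarrow> x \<notin> L \<Longrightarrow> y \<notin> L \<Longrightarrow> norm (g x - g y) < \<epsilon> / 2"
    using higson_functionsD[OF g E, of "\<epsilon> / 2"] e by auto
  have "norm ((f x + g x) - (f y + g y)) < \<epsilon>" if "(x, y) \<in> E" "x \<notin> K \<union> L" "y \<notin> K \<union> L" for x y
    using norm_diff_triangle_ineq[of "f x" "g x" "f y" "g y"] K(2)[of x y] L(2)[of x y] that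
    by auto
  then show "\<exists>K \<in> finitary_bornology G. \<forall>x y. (x, y) \<in> E \<longrightarrow> x \<notin> K \<longrightarrow> y \<notin> K \<longrightarrow>
      norm ((\<lambda>x\<in>carrier G. f x + g x) x - (\<lambda>x\<in>carrier G. f x + g x) y) < \<epsilon>"
    using finitary_entourage_subset[OF E] finitary_bornology_Un[OF K(1) L(1)]
    by (intro bexI[of _ "K \<union> L"]) auto
qed

lemma higson_mult:
  assumes f: "f \<in> higson_functions G" and g: "g \<in> higson_functions G"
  shows "(\<lambda>x\<in>carrier G. f x * g x) \<in> higson_functions G"
proof (rule higson_functionsI)
  obtain M where M0: "M > 0" and M: "\<And>x. x \<in> carrier G \<Longrightarrow> norm (f x) \<le> M"
    using bounded_functionsE[OF higson_bounded[OF f]] by blast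
  obtain N where N0: "N > 0" and N: "\<And>x. x \<in> carrier G \<Longrightarrow> norm (g x) \<le> N"
    using bounded_functionsE[OF higson_bounded[OF g]] by blast
  show "(\<lambda>x\<in>carrier G. f x * g x) \<in> bounded_functions G"
    using M0 by (intro bounded_functionsI[where M = "M * N"])
      (auto simp: norm_mult intro!: mult_mono M N)
  fix E and \<epsilon> :: real assume E: "E \<in> finitary_coarse_structure G" and e: "\<epsilon> > 0"
  obtain K where K: "K \<in> finitary_bornology G"
    "\<And>x y. (x, y) \<in> E \<Longrightarrow> x \<notin> K \<Longrightarrow> y \<notin> K \<Longrightarrow> norm (f x - f y) < \<epsilon> / (2 * N)"
    using higson_functionsD[OF f E, of "\<epsilon> / (2 * N)"] e N0 by auto
  obtain L where L: "L \<in> finitary_bornology G"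
    "\<And>x y. (x, y) \<in> E \<Longrightarrow> x \<notin> L \<Longrightarrow> y \<notin> L \<Longrightarrow> norm (g x - g y) < \<epsilon> / (2 * M)"
    using higson_functionsD[OF g E, of "\<epsilon> / (2 * M)"] e M0 by auto
  have "norm (f x * g x - f y * g y) < \<epsilon>" if xy: "(x, y) \<in> E" "x \<notin> K \<union> L" "y \<notin> K \<union> L" for x y
  proof -
    have c: "x \<in> carrier G" "y \<in> carrier G" using finitary_entourage_subset[OF E] xy by auto
    have "f x * g x - f y * g y = (f x - f y) * g x + f y * (g x - g y)"
      by (simp add: algebra_simps)
    then have "norm (f x * g x - f y * g y)
        \<le> norm (f x - f y) * norm (g x) + norm (f y) * norm (g x - g y)"
      by (metis norm_mult norm_triangle_ineq)
    also have "\<dots> \<le> norm (f x - f y) * N + M * norm (g x - g y)"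
      by (intro add_mono mult_mono M N c) (use M0 in auto)
    also have "\<dots> < \<epsilon> / (2 * N) * N + M * (\<epsilon> / (2 * M))"
      using K(2)[of x y] L(2)[of x y] xy M0 N0
      by (intro add_strict_mono mult_strict_right_mono mult_strict_left_mono) auto
    finally show ?thesis using M0 N0 by simp
  qed
  then show "\<exists>K \<in> finitary_bornology G. \<forall>x y. (x, y) \<in> E \<longrightarrow> x \<notin> K \<longrightarrow> y \<notin> K \<longrightarrow>
      norm ((\<lambda>x\<in>carrier G. f x * g x) x - (\<lambda>x\<in>carrier G. f x * g x) y) < \<epsilon>"
    using finitary_entourage_subset[OF E] finitary_bornology_Un[OF K(1) L(1)]
    by (intro bexI[of _ "K \<union> L"]) auto
qed

lemma higson_smult:
  assumes "f \<in> higson_functions G"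
  shows "(\<lambda>x\<in>carrier G. c * f x) \<in> higson_functions G"
proof -
  have "(\<lambda>x\<in>carrier G. c * f x) = (\<lambda>x\<in>carrier G. (\<lambda>x\<in>carrier G. c) x * f x)"
    by (rule restrict_ext) simp
  then show ?thesis using higson_mult[OF higson_const[of c G] assms] by simp
qed

lemma cring_higson_algebra: "cring (higson_algebra G)"
proof (rule cringI)
  show "abelian_group (higson_algebra G)"
  proof (rule abelian_groupI)
    fix f assume f: "f \<in> carrier (higson_algebra G)"
    then have "(\<lambda>x\<in>carrier G. - 1 * f x) \<in> higson_functions G"
      by (intro higson_smult) (simp add: higson_algebra_def)
    then show "\<exists>g\<in>carrier (higson_algebra G).
        g \<oplus>\<^bsub>higson_algebra G\<^esub> f = \<zero>\<^bsub>higson_algebra G\<^esub>"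
      by (intro bexI[of _ "\<lambda>x\<in>carrier G. - 1 * f x"]) (auto simp: higson_algebra_def)
  qed (auto simp: higson_algebra_def higson_add[unfolded restrict_def]
      higson_const[unfolded restrict_def] fun_eq_iff restrict_def
      dest: extensional_arb[OF higson_extensional])
  show "Group.comm_monoid (higson_algebra G)"
    by (rule comm_monoidI) (auto simp: higson_algebra_def higson_mult[unfolded restrict_def]
      higson_const[unfolded restrict_def] fun_eq_iff
      restrict_def dest: extensional_arb[OF higson_extensional])
qed (auto simp: higson_algebra_def fun_eq_iff restrict_def algebra_simps)

lemma algebra_higson_algebra:
  "algebra (ring_of_type_algebra :: complex ring) (higson_algebra G)"
  by (rule algebraI[OF cring_from_type_algebra cring_higson_algebra])
    (auto simp: higson_algebra_def ring_of_type_algebra_def higson_smult[unfolded restrict_def] fun_eq_iff restrict_def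
      algebra_simps dest: extensional_arb[OF higson_extensional])

lemma vanishing_functionsD:
  assumes "f \<in> vanishing_functions G" "\<epsilon> > 0"
  obtains F where "F \<in> finitary_bornology G" "\<And>x. x \<in> carrier G - F \<Longrightarrow> norm (f x) < \<epsilon>"
proof -
  have "\<exists>F \<in> finitary_bornology G. \<forall>x \<in> carrier G - F. norm (f x) < \<epsilon>"
    using assms unfolding vanishing_functions_def by blast
  then show ?thesis using that by blast
qed

lemma vanishing_subset_higson: "vanishing_functions G \<subseteq> higson_functions G"
proof
  fix f assume f: "f \<in> vanishing_functions G"
  show "f \<in> higson_functions G"
  proof (rule higson_functionsI)
    show "f \<in> bounded_functions G" using f by (simp add: vanishing_functions_def)
    fix E and \<epsilon> :: real assume E: "E \<in> finitary_coarse_structure G" and e: "\<epsilon> > 0"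
    obtain F where F: "F \<in> finitary_bornology G" "\<And>x. x \<in> carrier G - F \<Longrightarrow> norm (f x) < \<epsilon> / 2"
      using vanishing_functionsD[OF f, of "\<epsilon> / 2"] e by auto
    have "norm (f x - f y) < \<epsilon>" if "(x, y) \<in> E" "x \<notin> F" "y \<notin> F" for x y
      using norm_triangle_ineq4[of "f x" "f y"] F(2)[of x] F(2)[of y] that
        finitary_entourage_subset[OF E] by fastforce
    then show "\<exists>K \<in> finitary_bornology G. \<forall>x y. (x, y) \<in> E \<longrightarrow> x \<notin> K \<longrightarrow> y \<notin> K \<longrightarrow>
        norm (f x - f y) < \<epsilon>"
      using F(1) by blast
  qed
qed

lemma vanishing_add:
  assumes f: "f \<in> vanishing_functions G" and g: "g \<in> vanishing_functions G"
  shows "(\<lambda>x\<in>carrier G. f x + g x) \<in> vanishing_functions G"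
  unfolding vanishing_functions_def
proof (intro CollectI conjI allI impI)
  show "(\<lambda>x\<in>carrier G. f x + g x) \<in> bounded_functions G"
    by (rule higson_bounded[OF higson_add[OF subsetD[OF vanishing_subset_higson f]
          subsetD[OF vanishing_subset_higson g]]])
  fix \<epsilon> :: real assume e: "\<epsilon> > 0"
  obtain F where F: "F \<in> finitary_bornology G" "\<And>x. x \<in> carrier G - F \<Longrightarrow> norm (f x) < \<epsilon> / 2"
    using vanishing_functionsD[OF f, of "\<epsilon> / 2"] e by auto
  obtain H where H: "H \<in> finitary_bornology G" "\<And>x. x \<in> carrier G - H \<Longrightarrow> norm (g x) < \<epsilon> / 2"
    using vanishing_functionsD[OF g, of "\<epsilon> / 2"] e by auto
  have "norm (f x + g x) < \<epsilon>" if "x \<in> carrier G - (F \<union> H)" for x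
    using norm_triangle_ineq[of "f x" "g x"] F(2)[of x] H(2)[of x] that by auto
  then show "\<exists>F\<in>finitary_bornology G. \<forall>x\<in>carrier G - F.
      norm ((\<lambda>x\<in>carrier G. f x + g x) x) < \<epsilon>"
    using finitary_bornology_Un[OF F(1) H(1)] by (intro bexI[of _ "F \<union> H"]) auto
qed

lemma vanishing_mult:
  assumes f: "f \<in> vanishing_functions G" and g: "g \<in> higson_functions G"
  shows "(\<lambda>x\<in>carrier G. g x * f x) \<in> vanishing_functions G"
  unfolding vanishing_functions_def
proof (intro CollectI conjI allI impI)
  show "(\<lambda>x\<in>carrier G. g x * f x) \<in> bounded_functions G"
    by (rule higson_bounded[OF higson_mult[OF g subsetD[OF vanishing_subset_higson f]]])
  fix \<epsilon> :: real assume e: "\<epsilon> > 0"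
  obtain N where N0: "N > 0" and N: "\<And>x. x \<in> carrier G \<Longrightarrow> norm (g x) \<le> N"
    using bounded_functionsE[OF higson_bounded[OF g]] by blast
  have "\<epsilon> / N > 0" using e N0 by simp
  then obtain F where F: "F \<in> finitary_bornology G" "\<And>x. x \<in> carrier G - F \<Longrightarrow> norm (f x) < \<epsilon> / N"
    using vanishing_functionsD[OF f] by blast
  have "norm (g x * f x) < \<epsilon>" if x: "x \<in> carrier G - F" for x
  proof -
    have "norm (g x * f x) \<le> N * norm (f x)"
      using N[of x] x by (auto simp: norm_mult intro: mult_right_mono)
    also have "\<dots> < N * (\<epsilon> / N)" using F(2)[OF x] N0 by (intro mult_strict_left_mono)
    finally show ?thesis using N0 by simp
  qed
  then show "\<exists>F\<in>finitary_bornology G. \<forall>x\<in>carrier G - F.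
      norm ((\<lambda>x\<in>carrier G. g x * f x) x) < \<epsilon>"
    using F(1) by (intro bexI[of _ F]) auto
qed

lemma vanishing_zero: "(\<lambda>x\<in>carrier G. 0) \<in> vanishing_functions G"
  using higson_bounded[OF higson_const[of 0 G]]
  by (auto simp: vanishing_functions_def finitary_bornology_def)

lemma ideal_vanishing_functions: "ideal (vanishing_functions G) (higson_algebra G)"
proof -
  interpret cring "higson_algebra G" by (rule cring_higson_algebra)
  have comm: "f \<otimes>\<^bsub>higson_algebra G\<^esub> g = g \<otimes>\<^bsub>higson_algebra G\<^esub> f" for f g
    by (auto simp: higson_algebra_def mult.commute)
  show ?thesis
  proof (rule idealI)
    show "ring (higson_algebra G)" by (rule ring_axioms)
    show "subgroup (vanishing_functions G) (add_monoid (higson_algebra G))"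
    proof (rule add.subgroupI)
      fix f assume f: "f \<in> vanishing_functions G"
      then have fh: "f \<in> carrier (higson_algebra G)"
        using vanishing_subset_higson by (auto simp: higson_algebra_def)
      let ?h = "\<lambda>x\<in>carrier G. (\<lambda>x\<in>carrier G. - 1) x * f x"
      have h: "?h \<in> vanishing_functions G" by (rule vanishing_mult[OF f higson_const])
      have "?h \<oplus>\<^bsub>higson_algebra G\<^esub> f = \<zero>\<^bsub>higson_algebra G\<^esub>"
        by (auto simp: higson_algebra_def)
      moreover have "?h \<in> carrier (higson_algebra G)"
        using h vanishing_subset_higson by (auto simp: higson_algebra_def)
      ultimately have "\<ominus>\<^bsub>higson_algebra G\<^esub> f = ?h"
        using fh minus_equality by blast
      then show "\<ominus>\<^bsub>higson_algebra G\<^esub> f \<in> vanishing_functions G" using h by simp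
    next
      fix f g assume "f \<in> vanishing_functions G" "g \<in> vanishing_functions G"
      then show "f \<oplus>\<^bsub>higson_algebra G\<^esub> g \<in> vanishing_functions G"
        by (simp add: higson_algebra_def vanishing_add)
    qed (use vanishing_subset_higson vanishing_zero in \<open>auto simp: higson_algebra_def\<close>)
  next
    fix f g assume "f \<in> vanishing_functions G" "g \<in> carrier (higson_algebra G)"
    then show "g \<otimes>\<^bsub>higson_algebra G\<^esub> f \<in> vanishing_functions G"
      by (simp add: higson_algebra_def vanishing_mult)
    then show "f \<otimes>\<^bsub>higson_algebra G\<^esub> g \<in> vanishing_functions G"
      by (simp add: comm)
  qed
qed

lemma quotient_algebra_simps [simp]:
  "carrier (quotient_algebra A I) = a_rcosets\<^bsub>A\<^esub> I"
  "mult (quotient_algebra A I) = rcoset_mult A I"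
  "one (quotient_algebra A I) = I +>\<^bsub>A\<^esub> \<one>\<^bsub>A\<^esub>"
  "zero (quotient_algebra A I) = I"
  "add (quotient_algebra A I) = set_add A"
  "smult (quotient_algebra A I) = (\<lambda>c S. \<Union>x\<in>S. I +>\<^bsub>A\<^esub> (c \<odot>\<^bsub>A\<^esub> x))"
  by (simp_all add: quotient_algebra_def FactRing_def ring.defs module.defs)

lemma quotient_algebra_smult:
  assumes A: "algebra R A" and I: "ideal I A" and c: "c \<in> carrier R" and x: "x \<in> carrier A"
  shows "c \<odot>\<^bsub>quotient_algebra A I\<^esub> (I +>\<^bsub>A\<^esub> x) = I +>\<^bsub>A\<^esub> (c \<odot>\<^bsub>A\<^esub> x)"
proof -
  interpret algebra R A by (rule A)
  interpret I: ideal I A by (rule I)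
  have eq: "I +>\<^bsub>A\<^esub> (c \<odot>\<^bsub>A\<^esub> y) = I +>\<^bsub>A\<^esub> (c \<odot>\<^bsub>A\<^esub> x)" if y: "y \<in> I +>\<^bsub>A\<^esub> x" for y
  proof -
    obtain i where i: "i \<in> I" "y = i \<oplus>\<^bsub>A\<^esub> x" using y by (auto simp: a_r_coset_def')
    have iA: "i \<in> carrier A" using i(1) I.a_subset by blast
    have "c \<odot>\<^bsub>A\<^esub> i = (c \<odot>\<^bsub>A\<^esub> \<one>\<^bsub>A\<^esub>) \<otimes>\<^bsub>A\<^esub> i"
      using smult_assoc2[OF c, of "\<one>\<^bsub>A\<^esub>" i] iA by simp
    then have "c \<odot>\<^bsub>A\<^esub> i \<in> I" using I.I_l_closed[OF i(1), of "c \<odot>\<^bsub>A\<^esub> \<one>\<^bsub>A\<^esub>"] c by simp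
    moreover have "c \<odot>\<^bsub>A\<^esub> y = c \<odot>\<^bsub>A\<^esub> i \<oplus>\<^bsub>A\<^esub> c \<odot>\<^bsub>A\<^esub> x"
      using i(2) iA c x by (simp add: smult_r_distr)
    ultimately have "c \<odot>\<^bsub>A\<^esub> y \<in> I +>\<^bsub>A\<^esub> (c \<odot>\<^bsub>A\<^esub> x)" by (auto simp: a_r_coset_def')
    then show ?thesis
      using abelian_group.a_repr_independence[OF ring.is_abelian_group[OF ideal.axioms(2)[OF I]]
          _ _ I.a_subgroup] c x
      by (metis smult_closed)
  qed
  have "x \<in> I +>\<^bsub>A\<^esub> x" using x by (rule I.a_rcos_self)
  then have "(\<Union>y\<in>I +>\<^bsub>A\<^esub> x. I +>\<^bsub>A\<^esub> (c \<odot>\<^bsub>A\<^esub> y)) = I +>\<^bsub>A\<^esub> (c \<odot>\<^bsub>A\<^esub> x)"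
    using eq by blast
  then show ?thesis by simp
qed

end

theory Submission
  imports Defs
begin

text \<open>Call \<open>A \<subseteq> G\<close> almost invariant if \<open>A\<close> and \<open>A k\<close> differ by a finite set for every \<open>k\<close>. In an
  uncountable locally finite group such a set is finite or cofinite: otherwise there is a
  countable subgroup \<open>M\<close> meeting both \<open>A\<close> and its complement in infinite sets such that \<open>A\<close> is a
  union of left cosets of \<open>M\<close> off \<open>M\<close>. For \<open>k \<notin> M\<close> and a large finite subgroup \<open>F \<le> M\<close>, the coset
  \<open>F\<close> would be a cut vertex, up to boundedly many edges, of a coset graph of the finite group
  generated by \<open>F\<close> and \<open>k\<close>. Uncrossing the cut with its translates excludes this.

  The corona is a continuous image of the set of cluster points at infinity of the evaluation map
  from \<open>G\<close> to a product of copies of the complex plane. Disjoint open sets of the product that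
  separate this set into two nonempty parts pull back to an almost invariant set that is infinite
  and has infinite complement.\<close>

section \<open>Cuts in finite groups\<close>

text \<open>The edge boundary of \<open>A\<close> in the Cayley graph with the edges from
  \<open>x\<close> to \<open>x k\<close>, each edge being recorded by its tail.\<close>

definition translation_cut :: "('a, 'm) monoid_scheme \<Rightarrow> 'a \<Rightarrow> 'a set \<Rightarrow> 'a set" where
  "translation_cut G k A = {x \<in> carrier G. (x \<in> A) \<noteq> (x \<otimes>\<^bsub>G\<^esub> k \<in> A)}"

text \<open>The translate \<open>x A\<close>, encoded as a preimage so that membership unfolds
  without an existential.\<close>

definition left_translate :: "('a, 'm) monoid_scheme \<Rightarrow> 'a \<Rightarrow> 'a set \<Rightarrow> 'a set" where
  "left_translate G x A = {y \<in> carrier G. inv\<^bsub>G\<^esub> x \<otimes>\<^bsub>G\<^esub> y \<in> A}"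

text \<open>For a subgroup \<open>F\<close> these are the unions of left cosets of \<open>F\<close>,
  that is, the vertex sets of the coset graph.\<close>

definition right_invariant :: "('a, 'm) monoid_scheme \<Rightarrow> 'a set \<Rightarrow> 'a set \<Rightarrow> bool" where
  "right_invariant G F A \<longleftrightarrow>
     A \<subseteq> carrier G \<and> (\<forall>x \<in> carrier G. \<forall>f \<in> F. x \<otimes>\<^bsub>G\<^esub> f \<in> A \<longleftrightarrow> x \<in> A)"

context group
begin

section \<open>Edge boundaries under set operations and left translation\<close>

lemma translation_cut_Diff:
  "k \<in> carrier G \<Longrightarrow> translation_cut G k (carrier G - A) = translation_cut G k A"
  by (auto simp: translation_cut_def)

text \<open>Submodularity of the cut: an edge cut by one of the corners is cut by \<open>A\<close>
  or \<open>B\<close>, and an edge cut by both corners is cut by both sets.\<close>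

lemma translation_cut_Int_Un:
  assumes "finite (carrier G)"
  shows "card (translation_cut G k (A \<inter> B)) + card (translation_cut G k (A \<union> B))
    \<le> card (translation_cut G k A) + card (translation_cut G k B)"
proof -
  let ?c = "translation_cut G k"
  have fin: "finite (?c W)" for W using assms by (simp add: translation_cut_def)
  have "card (?c (A \<inter> B)) + card (?c (A \<union> B))
      = card (?c (A \<inter> B) \<union> ?c (A \<union> B)) + card (?c (A \<inter> B) \<inter> ?c (A \<union> B))"
    by (rule card_Un_Int[OF fin fin])
  also have "\<dots> \<le> card (?c A \<union> ?c B) + card (?c A \<inter> ?c B)"
    by (intro add_mono card_mono) (auto simp: fin, auto simp: translation_cut_def)
  also have "\<dots> = card (?c A) + card (?c B)" by (rule card_Un_Int[OF fin fin, symmetric])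
  finally show ?thesis .
qed

lemma left_translate_eq_image:
  assumes "x \<in> carrier G" "A \<subseteq> carrier G"
  shows "left_translate G x A = (\<lambda>y. x \<otimes> y) ` A"
proof safe
  fix y assume "y \<in> left_translate G x A"
  then have "y \<in> carrier G" "inv x \<otimes> y \<in> A" by (auto simp: left_translate_def)
  then show "y \<in> (\<lambda>y. x \<otimes> y) ` A"
    using assms by (intro image_eqI[of _ _ "inv x \<otimes> y"]) (auto simp: inv_solve_left m_assoc[symmetric])
next
  fix y assume "y \<in> A"
  then show "x \<otimes> y \<in> left_translate G x A"
    using assms by (auto simp: left_translate_def m_assoc[symmetric])
qed

lemma card_left_translate:
  assumes "x \<in> carrier G" "A \<subseteq> carrier G"
  shows "card (left_translate G x A) = card A"
  unfolding left_translate_eq_image[OF assms]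
  by (rule card_image, rule inj_onI) (use assms in \<open>metis l_cancel subsetD\<close>)

text \<open>Left multiplication commutes with right multiplication by \<open>k\<close>, so it acts
  by automorphisms of the graph.\<close>

lemma translation_cut_left_translate:
  assumes "x \<in> carrier G" "k \<in> carrier G"
  shows "translation_cut G k (left_translate G x A) = left_translate G x (translation_cut G k A)"
  using assms by (auto simp: translation_cut_def left_translate_def m_assoc)

lemma card_translation_cut_left_translate:
  assumes "x \<in> carrier G" "k \<in> carrier G"
  shows "card (translation_cut G k (left_translate G x A)) = card (translation_cut G k A)"
  unfolding translation_cut_left_translate[OF assms]
  by (rule card_left_translate) (use assms in \<open>auto simp: translation_cut_def\<close>)

lemma right_invariant_left_translate:
  assumes "right_invariant G F A" "x \<in> carrier G" "F \<subseteq> carrier G"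
  shows "right_invariant G F (left_translate G x A)"
  unfolding right_invariant_def
proof (intro conjI ballI)
  fix y f assume "y \<in> carrier G" "f \<in> F"
  moreover from this have "f \<in> carrier G" using assms by blast
  ultimately have "inv x \<otimes> (y \<otimes> f) \<in> A \<longleftrightarrow> inv x \<otimes> y \<in> A"
    using assms by (simp add: right_invariant_def m_assoc[symmetric])
  then show "y \<otimes> f \<in> left_translate G x A \<longleftrightarrow> y \<in> left_translate G x A"
    using \<open>y \<in> carrier G\<close> \<open>f \<in> carrier G\<close> by (simp add: left_translate_def)
qed (auto simp: left_translate_def)

text \<open>A set of minimal cut and then of minimal size meets none of its proper translates
  (uncrossing), so its translate through the unit is a subgroup, all of which is cut.\<close>

lemma right_invariant_small_cut:
  assumes fin: "finite (carrier G)" and F: "subgroup F G" and k: "k \<in> carrier G"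
    and gen: "\<And>H. subgroup H G \<Longrightarrow> F \<subseteq> H \<Longrightarrow> k \<in> H \<Longrightarrow> H = carrier G"
    and Q: "right_invariant G F Q" and small: "card (translation_cut G k Q) < card F"
  shows "Q = {} \<or> Q = carrier G"
proof (rule ccontr)
  assume nontriv: "\<not> (Q = {} \<or> Q = carrier G)"
  let ?c = "\<lambda>W. card (translation_cut G k W)"
  define S where "S = {W. right_invariant G F W \<and> W \<noteq> {} \<and> W \<noteq> carrier G}"
  have QS: "Q \<in> S" using Q nontriv by (simp add: S_def)
  define m where "m = (LEAST n. \<exists>W\<in>S. ?c W = n)"
  have ex: "\<exists>W\<in>S. ?c W = m" unfolding m_def by (rule LeastI_ex) (use QS in blast)
  have m_le: "m \<le> ?c W" if "W \<in> S" for W unfolding m_def by (rule Least_le) (use that in blast)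
  define s where "s = (LEAST n. \<exists>W\<in>S. ?c W = m \<and> card W = n)"
  have "\<exists>W\<in>S. ?c W = m \<and> card W = s" unfolding s_def by (rule LeastI_ex) (use ex in blast)
  then obtain W0 where W0: "W0 \<in> S" "?c W0 = m" "card W0 = s" by blast
  have s_le: "s \<le> card W" if "W \<in> S" "?c W = m" for W
    unfolding s_def by (rule Least_le) (use that in blast)
  have F_carr: "F \<subseteq> carrier G" by (rule subgroup.subset[OF F])
  have S_translate: "left_translate G x W \<in> S" if "x \<in> carrier G" "W \<in> S" for x W
  proof -
    have "right_invariant G F (left_translate G x W)"
      using that right_invariant_left_translate F_carr by (simp add: S_def)
    moreover have "W \<subseteq> carrier G" using that by (simp add: S_def right_invariant_def)
    moreover have "0 < card W" "card W < card (carrier G)"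
      using that \<open>W \<subseteq> carrier G\<close> fin
      by (auto simp: S_def card_gt_0_iff intro: finite_subset psubset_card_mono)
    ultimately show ?thesis
      using card_left_translate[OF that(1), of W] by (auto simp: S_def)
  qed
  obtain x0 where x0: "x0 \<in> W0" using W0(1) by (auto simp: S_def)
  then have x0c: "x0 \<in> carrier G" using W0(1) by (auto simp: S_def right_invariant_def)
  have W0c: "W0 \<subseteq> carrier G" using W0(1) by (auto simp: S_def right_invariant_def)
  define W where "W = left_translate G (inv x0) W0"
  have WS: "W \<in> S" unfolding W_def using x0c W0(1) by (intro S_translate) auto
  have Wc: "W \<subseteq> carrier G" using WS by (auto simp: S_def right_invariant_def)
  have Wm: "?c W = m" unfolding W_def using x0c W0(2) k
    by (simp add: card_translation_cut_left_translate)
  have Ws: "card W = s" unfolding W_def using x0c W0c W0(3)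
    by (simp add: card_left_translate)
  have one: "\<one> \<in> W" unfolding W_def using x0 x0c by (simp add: left_translate_def)
  have finW: "finite W" using Wc fin finite_subset by blast
  \<comment> \<open>The complement competes with \<open>W\<close>, having the same cut. This later
    keeps the union of \<open>W\<close> with an overlapping translate from filling the
    group.\<close>
  have half: "2 * s \<le> card (carrier G)"
  proof -
    have "carrier G - W \<in> S"
      using WS F_carr by (auto simp: S_def right_invariant_def)
    moreover have "?c (carrier G - W) = m" using Wm k by (simp add: translation_cut_Diff)
    ultimately have "s \<le> card (carrier G - W)" by (rule s_le)
    also have "\<dots> = card (carrier G) - s" using Ws Wc finW by (simp add: card_Diff_subset)
    finally show ?thesis using card_mono[OF fin Wc] Ws by linarith
  qed
  have translate_eq: "left_translate G x W = W" if x: "x \<in> W" for x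
  proof -
    let ?Y = "left_translate G x W"
    have xc: "x \<in> carrier G" using x Wc by blast
    have YS: "?Y \<in> S" by (rule S_translate[OF xc WS])
    have Yc: "?Y \<subseteq> carrier G" by (auto simp: left_translate_def)
    have cardY: "card ?Y = s" using card_left_translate[OF xc Wc] Ws by simp
    have "x \<in> W \<inter> ?Y" using x xc one by (simp add: left_translate_def)
    have finY: "finite ?Y" using Yc fin finite_subset by blast
    \<comment> \<open>The common point \<open>x\<close> makes the union smaller than
      \<open>2 * s\<close>, so both corners are nontrivial competitors.\<close>
    have "card (W \<union> ?Y) + card (W \<inter> ?Y) = 2 * s"
      using card_Un_Int[OF finW finY] Ws cardY by simp
    moreover have "card (W \<inter> ?Y) > 0" using \<open>x \<in> W \<inter> ?Y\<close> finW by (auto simp: card_gt_0_iff)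
    ultimately have "W \<union> ?Y \<noteq> carrier G" using half by auto
    then have "W \<union> ?Y \<in> S" "W \<inter> ?Y \<in> S"
      using WS YS \<open>x \<in> W \<inter> ?Y\<close> by (auto simp: S_def right_invariant_def)
    \<comment> \<open>Both corners have cut at least \<open>m\<close>, so submodularity forces
      equality; minimal size then makes the intersection all of \<open>W\<close> and all of
      \<open>?Y\<close>.\<close>
    moreover have "?c (W \<inter> ?Y) + ?c (W \<union> ?Y) \<le> 2 * m"
      using translation_cut_Int_Un[OF fin, of k W ?Y] Wm
        card_translation_cut_left_translate[OF xc k, of W] by simp
    ultimately have "?c (W \<inter> ?Y) = m"
      using m_le[of "W \<inter> ?Y"] m_le[of "W \<union> ?Y"] by linarith
    then have "s \<le> card (W \<inter> ?Y)" using \<open>W \<inter> ?Y \<in> S\<close> by (intro s_le)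
    then have "W \<inter> ?Y = W" "W \<inter> ?Y = ?Y"
      using card_seteq[OF finW, of "W \<inter> ?Y"] card_seteq[OF finY, of "W \<inter> ?Y"] Ws cardY by auto
    then show ?thesis by simp
  qed
  have "subgroup W G"
  proof (rule subgroupI)
    show "W \<noteq> {}" using one by blast
    fix x assume x: "x \<in> W"
    then have xc: "x \<in> carrier G" using Wc by blast
    show "inv x \<in> W"
    proof -
      have "\<one> \<in> left_translate G x W" using translate_eq[OF x] one by simp
      then show ?thesis using xc by (simp add: left_translate_def)
    qed
    fix y assume y: "y \<in> W"
    have "x \<otimes> y \<in> left_translate G x W"
      using x y xc Wc by (auto simp: left_translate_eq_image)
    then show "x \<otimes> y \<in> W" using translate_eq[OF x] by simp
  qed (rule Wc)
  moreover have "F \<subseteq> W"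
  proof
    fix f assume f: "f \<in> F"
    then have "\<one> \<otimes> f \<in> W" using WS one by (auto simp: S_def right_invariant_def)
    then show "f \<in> W" using f F_carr by auto
  qed
  \<comment> \<open>\<open>F\<close> and \<open>k\<close> generate the group, so a proper subgroup
    above \<open>F\<close> misses \<open>k\<close>. Every edge starting in \<open>W\<close>
    therefore leaves it, giving at least \<open>card F\<close> cut edges.\<close>
  ultimately have kW: "k \<notin> W" using gen[of W] WS by (auto simp: S_def)
  have "W \<subseteq> translation_cut G k W"
  proof
    fix x assume x: "x \<in> W"
    have "x \<otimes> k \<notin> W"
    proof
      assume "x \<otimes> k \<in> W"
      then have "inv x \<otimes> (x \<otimes> k) \<in> W"
        using \<open>subgroup W G\<close> x by (metis subgroup.m_closed subgroup.m_inv_closed)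
      then show False using kW k x Wc by (auto simp: m_assoc[symmetric])
    qed
    then show "x \<in> translation_cut G k W" using x Wc by (auto simp: translation_cut_def)
  qed
  moreover have "finite (translation_cut G k W)" using fin by (simp add: translation_cut_def)
  ultimately have "card W \<le> m" unfolding Wm[symmetric] by (intro card_mono)
  moreover have "card F \<le> card W" using \<open>F \<subseteq> W\<close> finW by (rule card_mono[rotated])
  ultimately show False using small m_le[OF QS] by linarith
qed

text \<open>The only coset that \<open>C\<close> may split is \<open>F\<close>. For \<open>x\<close>
  in \<open>C\<close> outside \<open>F\<close>, the translate \<open>x C\<close> may split only
  \<open>x F\<close>, so a suitable corner of the two sets splits no coset and is empty by
  \<open>right_invariant_small_cut\<close>. Comparing sizes excludes such an \<open>x\<close>. Hence
  \<open>C\<close> lies in \<open>F\<close>, and multiplication by \<open>k\<close> moves all of it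
  out of \<open>F\<close>.\<close>

lemma card_le_cut_if_split:
  assumes fin: "finite (carrier G)" and F: "subgroup F G" and k: "k \<in> carrier G" "k \<notin> F"
    and gen: "\<And>H. subgroup H G \<Longrightarrow> F \<subseteq> H \<Longrightarrow> k \<in> H \<Longrightarrow> H = carrier G"
    and C: "C \<subseteq> carrier G" "\<And>x f. x \<in> carrier G - F \<Longrightarrow> f \<in> F \<Longrightarrow> x \<otimes> f \<in> C \<longleftrightarrow> x \<in> C"
    and small: "2 * card (translation_cut G k C) < card F"
    and split: "F \<inter> C \<noteq> {}" and half: "2 * card C \<le> card (carrier G)"
  shows "card C \<le> card (translation_cut G k C)"
proof -
  interpret F: subgroup F G by (rule F)
  obtain a where a: "a \<in> F" "a \<in> C" using split by blast
  have ac: "a \<in> carrier G" using a by (intro F.mem_carrier)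
  have finC: "finite C" using C(1) fin finite_subset by blast
  have fin_cut: "finite (translation_cut G k W)" for W using fin by (simp add: translation_cut_def)
  have F_mult: "x \<otimes> f \<in> F \<longleftrightarrow> x \<in> F" if "x \<in> carrier G" "f \<in> F" for x f
    using that by (metis F.m_closed F.m_inv_closed F.mem_carrier inv_solve_right')
  have "C \<subseteq> F"
  proof (rule ccontr)
    assume "\<not> C \<subseteq> F"
    then obtain x where x: "x \<in> C" "x \<notin> F" by blast
    have xc: "x \<in> carrier G" using x C by blast
    have ix: "inv x \<notin> F" using x xc F.m_inv_closed[of "inv x"] by auto
    let ?T = "left_translate G x C"
    have finT: "finite ?T" using fin by (simp add: left_translate_def)
    have cardT: "card ?T = card C" by (rule card_left_translate[OF xc C(1)])
    \<comment> \<open>Since \<open>inv x\<close> is outside \<open>F\<close>, its coset is not split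
      by \<open>C\<close>; so \<open>F\<close> lies wholly inside or wholly outside
      \<open>?T\<close>.\<close>
    have F_T: "y \<in> ?T \<longleftrightarrow> inv x \<in> C" if "y \<in> F" for y
      using C(2)[of "inv x" y] that xc ix by (auto simp: left_translate_def)
    \<comment> \<open>The coset \<open>x F\<close> lies wholly inside \<open>C\<close>.\<close>
    have xF_C: "y \<in> C" if "y \<in> carrier G" "inv x \<otimes> y \<in> F" for y
    proof -
      have "x \<otimes> (inv x \<otimes> y) = y" using that xc by (simp add: m_assoc[symmetric])
      then show ?thesis using C(2)[of x "inv x \<otimes> y"] x xc that by simp
    qed
    \<comment> \<open>\<open>E\<close> avoids \<open>F\<close> because \<open>D\<close> does, and
      avoids \<open>x F\<close> because that coset lies in \<open>C\<close>; these are the only two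
      cosets that could be split.\<close>
    have corner: "E = {}"
      if E: "E = (carrier G - C) \<inter> D" and D: "D = ?T \<or> D = carrier G - ?T" and FD: "F \<inter> D = {}"
      for E D
    proof -
      have inv: "right_invariant G F E"
        unfolding right_invariant_def
      proof (intro conjI ballI)
        show "E \<subseteq> carrier G" using E by blast
        fix y f assume y: "y \<in> carrier G" and f: "f \<in> F"
        have fc: "f \<in> carrier G" using f by (intro F.mem_carrier)
        have yf: "y \<otimes> f \<in> carrier G" using y fc by simp
        have assoc: "inv x \<otimes> (y \<otimes> f) = (inv x \<otimes> y) \<otimes> f" using xc y fc by (simp add: m_assoc)
        consider "y \<in> F" | "inv x \<otimes> y \<in> F" | "y \<notin> F" "inv x \<otimes> y \<notin> F" by blast
        then show "y \<otimes> f \<in> E \<longleftrightarrow> y \<in> E"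
        proof cases
          case 1
          then show ?thesis using FD E f F_mult[OF y f] by blast
        next
          case 2
          then have "inv x \<otimes> (y \<otimes> f) \<in> F" using assoc f by simp
          then have "y \<otimes> f \<in> C" "y \<in> C" using xF_C 2 y yf by blast+
          then show ?thesis using E by blast
        next
          case 3
          have "y \<otimes> f \<in> C \<longleftrightarrow> y \<in> C" using C(2) 3 y f by blast
          moreover have "y \<otimes> f \<in> ?T \<longleftrightarrow> y \<in> ?T"
            using C(2)[of "inv x \<otimes> y" f] 3 y yf xc f assoc by (simp add: left_translate_def)
          ultimately show ?thesis using E D y yf by blast
        qed
      qed
      \<comment> \<open>The corner may inherit the cuts of both sets, whence the factor 2 in
        \<open>small\<close>.\<close>
      have "translation_cut G k E \<subseteq> translation_cut G k C \<union> translation_cut G k ?T"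
        using E D k by (auto simp: translation_cut_def)
      then have "card (translation_cut G k E)
          \<le> card (translation_cut G k C \<union> translation_cut G k ?T)"
        by (intro card_mono) (simp_all add: fin_cut)
      also have "\<dots> \<le> card (translation_cut G k C) + card (translation_cut G k ?T)"
        by (rule card_Un_le)
      also have "\<dots> < card F"
        using small card_translation_cut_left_translate[OF xc k(1), of C] by simp
      finally have "E = {} \<or> E = carrier G"
        by (intro right_invariant_small_cut[OF fin F k(1) gen inv])
      then show ?thesis using E a ac by blast
    qed
    show False
    proof (cases "inv x \<in> C")
      case False
      then have "F \<inter> ?T = {}" using F_T by blast
      then have "(carrier G - C) \<inter> ?T = {}" using corner by blast
      \<comment> \<open>Equal cardinalities give \<open>?T = C\<close>, yet \<open>a\<close> lies in
        \<open>F\<close> and \<open>C\<close> while \<open>?T\<close> misses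
        \<open>F\<close>.\<close>
      then have "?T \<subseteq> C" by (auto simp: left_translate_def)
      then have "?T = C" using cardT finC by (simp add: card_seteq)
      then show False using \<open>F \<inter> ?T = {}\<close> a by blast
    next
      case True
      then have "F \<subseteq> ?T" using F_T by blast
      then have "(carrier G - C) \<inter> (carrier G - ?T) = {}" using corner by blast
      \<comment> \<open>Two sets of at most half the size that cover the group are disjoint, yet
        \<open>a\<close> lies in both.\<close>
      then have "carrier G = C \<union> ?T" using C by (auto simp: left_translate_def)
      moreover have "card C + card ?T = card (C \<union> ?T) + card (C \<inter> ?T)"
        by (rule card_Un_Int[OF finC finT])
      ultimately have "card (C \<inter> ?T) = 0" using half cardT by simp
      then show False using a \<open>F \<subseteq> ?T\<close> finC by auto
    qed
  qed
  have "C \<subseteq> translation_cut G k C"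
  proof
    fix y assume y: "y \<in> C"
    have "y \<otimes> k \<notin> F"
    proof
      assume "y \<otimes> k \<in> F"
      moreover have "inv y \<in> F" using y \<open>C \<subseteq> F\<close> by blast
      ultimately have "inv y \<otimes> (y \<otimes> k) \<in> F" by blast
      then show False using k y C by (auto simp: m_assoc[symmetric])
    qed
    then show "y \<in> translation_cut G k C" using y C \<open>C \<subseteq> F\<close> by (auto simp: translation_cut_def)
  qed
  then show ?thesis by (intro card_mono fin_cut)
qed

text \<open>One of \<open>C\<close> and its complement has at most half of the elements. If it meets
  \<open>F\<close>, \<open>card_le_cut_if_split\<close> bounds its size; otherwise its part in
  \<open>F\<close> is empty. The complement has the same cut.\<close>

lemma nearly_constant_on_subgroup:
  assumes fin: "finite (carrier G)" and F: "subgroup F G" and k: "k \<in> carrier G" "k \<notin> F"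
    and gen: "\<And>H. subgroup H G \<Longrightarrow> F \<subseteq> H \<Longrightarrow> k \<in> H \<Longrightarrow> H = carrier G"
    and C: "C \<subseteq> carrier G" "\<And>x f. x \<in> carrier G - F \<Longrightarrow> f \<in> F \<Longrightarrow> x \<otimes> f \<in> C \<longleftrightarrow> x \<in> C"
    and small: "2 * card (translation_cut G k C) < card F"
  shows "card (F \<inter> C) \<le> card (translation_cut G k C)
    \<or> card (F - C) \<le> card (translation_cut G k C)"
proof -
  let ?D = "carrier G - C"
  have Fc: "F \<subseteq> carrier G" by (rule subgroup.subset[OF F])
  have finC: "finite C" using C(1) fin finite_subset by blast
  have FC: "card (F \<inter> C) \<le> card C" using finC by (intro card_mono) auto
  have FD: "card (F - C) \<le> card ?D" using fin Fc by (intro card_mono) auto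
  have "card ?D = card (carrier G) - card C" using finC C by (simp add: card_Diff_subset)
  then consider "F \<inter> C = {}" | "F - C = {}" | "F \<inter> C \<noteq> {}" "2 * card C \<le> card (carrier G)"
    | "F - C \<noteq> {}" "2 * card ?D \<le> card (carrier G)"
    by linarith
  then show ?thesis
  proof cases
    case 3
    have "card C \<le> card (translation_cut G k C)"
      by (rule card_le_cut_if_split[OF fin F k gen C small 3])
    then show ?thesis using FC by simp
  next
    case 4
    have "card ?D \<le> card (translation_cut G k ?D)"
    proof (rule card_le_cut_if_split[OF fin F k gen])
      show "x \<otimes> f \<in> ?D \<longleftrightarrow> x \<in> ?D" if "x \<in> carrier G - F" "f \<in> F" for x f
        using C(2)[OF that] that Fc by auto
    qed (use small 4 Fc translation_cut_Diff[OF k(1)] in auto)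
    then show ?thesis using FD translation_cut_Diff[OF k(1), of C] by simp
  qed (simp_all only: card.empty le0 simp_thms)
qed

end

section \<open>Almost invariant sets\<close>

context group
begin

text \<open>A Loewenheim-Skolem closure: countably many rounds of adjoining products, inverses and
  the sets \<open>D k\<close> keep the set countable.\<close>

lemma countable_closed_subgroup:
  assumes S: "countable S" "S \<subseteq> carrier G"
    and D: "\<And>k. k \<in> carrier G \<Longrightarrow> countable (D k)" "\<And>k. D k \<subseteq> carrier G"
  obtains M where "subgroup M G" "countable M" "S \<subseteq> M" "\<And>k. k \<in> M \<Longrightarrow> D k \<subseteq> M"
proof -
  define step where
    "step T = T \<union> (\<lambda>(x, y). x \<otimes> y) ` (T \<times> T) \<union> m_inv G ` T \<union> (\<Union>k\<in>T. D k)" for T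
  define Ms where "Ms n = (step ^^ n) (insert \<one> S)" for n
  have Ms_Suc: "Ms (Suc n) = step (Ms n)" for n by (simp add: Ms_def)
  have Ms: "countable (Ms n) \<and> Ms n \<subseteq> carrier G" for n
  proof (induction n)
    case 0
    then show ?case using S by (simp add: Ms_def)
  next
    case (Suc n)
    have "countable (step (Ms n))" unfolding step_def using Suc D(1)
      by (intro countable_Un countable_image countable_SIGMA countable_UN) auto
    moreover have "step (Ms n) \<subseteq> carrier G" using Suc D(2) unfolding step_def by auto
    ultimately show ?case by (simp add: Ms_Suc)
  qed
  \<comment> \<open>Monotonicity puts any two elements of the union into a common stage, where their
    product is formed next.\<close>
  have "incseq Ms" by (rule incseq_SucI) (auto simp: Ms_Suc step_def)
  define M where "M = (\<Union>n. Ms n)"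
  have M_carr: "M \<subseteq> carrier G" using Ms unfolding M_def by blast
  show thesis
  proof
    show "subgroup M G"
    proof (rule subgroupI)
      have "\<one> \<in> Ms 0" by (simp add: Ms_def)
      then show "M \<noteq> {}" unfolding M_def by blast
      fix x assume "x \<in> M"
      then obtain i where i: "x \<in> Ms i" unfolding M_def by blast
      then have "inv x \<in> Ms (Suc i)" by (simp add: Ms_Suc step_def)
      then show "inv x \<in> M" unfolding M_def by blast
      fix y assume "y \<in> M"
      then obtain j where j: "y \<in> Ms j" unfolding M_def by blast
      have "x \<in> Ms (max i j)" "y \<in> Ms (max i j)"
        using i j \<open>incseq Ms\<close> by (meson incseq_def max.cobounded1 max.cobounded2 subsetD)+
      then have "x \<otimes> y \<in> Ms (Suc (max i j))" by (auto simp: Ms_Suc step_def)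
      then show "x \<otimes> y \<in> M" unfolding M_def by blast
    qed (rule M_carr)
    show "countable M" unfolding M_def using Ms by (intro countable_UN) auto
    have "S \<subseteq> Ms 0" by (auto simp: Ms_def)
    then show "S \<subseteq> M" unfolding M_def by blast
    fix k assume "k \<in> M"
    then obtain i where "k \<in> Ms i" unfolding M_def by blast
    then have "D k \<subseteq> Ms (Suc i)" by (auto simp: Ms_Suc step_def)
    then show "D k \<subseteq> M" unfolding M_def by blast
  qed
qed

text \<open>The contradiction is numerical. With \<open>d\<close> the size of the cut at some
  \<open>k\<close> outside \<open>M\<close>, the finite group \<open>L \<inter> M\<close> is made to
  contain \<open>d + 1\<close> points of \<open>A\<close> and \<open>d + 1\<close> points outside
  \<open>A\<close>, whereas \<open>nearly_constant_on_subgroup\<close> allows at most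
  \<open>d\<close> on one of the two sides.\<close>

lemma almost_invariant_finite_or_cofinite:
  assumes lf: "locally_finite_group G" and unc: "uncountable (carrier G)"
    and A: "A \<subseteq> carrier G"
    and cut: "\<And>k. k \<in> carrier G \<Longrightarrow> finite (translation_cut G k A)"
  shows "finite A \<or> finite (carrier G - A)"
proof (rule ccontr)
  assume "\<not> (finite A \<or> finite (carrier G - A))"
  then have inf: "infinite A" "infinite (carrier G - A)" by auto
  obtain S1 where S1: "S1 \<subseteq> A" "infinite S1" "countable S1"
    using infinite_countable_subset'[OF inf(1)] by blast
  obtain S2 where S2: "S2 \<subseteq> carrier G - A" "infinite S2" "countable S2"
    using infinite_countable_subset'[OF inf(2)] by blast
  have "countable (S1 \<union> S2)" "S1 \<union> S2 \<subseteq> carrier G" using S1 S2 A by auto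
  then obtain M where M: "subgroup M G" "countable M" "S1 \<union> S2 \<subseteq> M"
      and closed: "\<And>k. k \<in> M \<Longrightarrow> translation_cut G k A \<subseteq> M"
    by (rule countable_closed_subgroup[where D = "\<lambda>k. translation_cut G k A"])
      (use cut in \<open>auto simp: translation_cut_def intro: countable_finite\<close>)
  have M_carr: "M \<subseteq> carrier G" by (rule subgroup.subset[OF M(1)])
  \<comment> \<open>Uncountability enters here. The element \<open>k\<close> and the bound
    \<open>d\<close> are fixed before the finite sets of generators are chosen.\<close>
  obtain k where k: "k \<in> carrier G" "k \<notin> M"
    using unc M(2) M_carr by (metis countable_subset subsetI)
  define d where "d = card (translation_cut G k A)"
  \<comment> \<open>One point more than \<open>d\<close> on each side contradicts the final bound,
    and together they give \<open>2 * d < card (L \<inter> M)\<close>.\<close>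
  obtain T1 where T1: "T1 \<subseteq> S1" "card T1 = Suc d" "finite T1"
    using infinite_arbitrarily_large[OF S1(2)] by metis
  obtain T2 where T2: "T2 \<subseteq> S2" "card T2 = Suc d" "finite T2"
    using infinite_arbitrarily_large[OF S2(2)] by metis
  define gens where "gens = insert k (T1 \<union> T2)"
  define L where "L = generate G gens"
  have gens: "finite gens" "gens \<subseteq> carrier G"
    using k T1 T2 S1 S2 A unfolding gens_def by auto
  have finL: "finite L" using lf gens unfolding locally_finite_group_def L_def by blast
  have L: "subgroup L G" unfolding L_def by (rule generate_is_subgroup[OF gens(2)])
  have L_carr: "L \<subseteq> carrier G" by (rule subgroup.subset[OF L])
  have gens_L: "gens \<subseteq> L" unfolding L_def by (auto intro: generate.incl)
  let ?H = "G\<lparr>carrier := L\<rparr>"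
  interpret H: group ?H by (rule subgroup_imp_group[OF L])
  have cut_L: "translation_cut ?H k (A \<inter> L) \<subseteq> translation_cut G k A"
    using gens_L L_carr L by (auto simp: translation_cut_def gens_def subgroup.m_closed)
  then have cut_le: "card (translation_cut ?H k (A \<inter> L)) \<le> d"
    unfolding d_def by (rule card_mono[OF cut[OF k(1)]])
  have "T1 \<union> T2 \<subseteq> L \<inter> M" using gens_L M(3) T1 T2 by (auto simp: gens_def)
  moreover have "finite (L \<inter> M)" using finL by simp
  moreover have "T1 \<inter> T2 = {}" using T1 T2 S1 S2 by blast
  ultimately have card_F: "2 * d < card (L \<inter> M)"
    using card_mono[of "L \<inter> M" "T1 \<union> T2"] T1 T2 by (simp add: card_Un_disjoint)
  have "card (L \<inter> M \<inter> (A \<inter> L)) \<le> card (translation_cut ?H k (A \<inter> L))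
      \<or> card (L \<inter> M - A \<inter> L) \<le> card (translation_cut ?H k (A \<inter> L))"
  proof (rule H.nearly_constant_on_subgroup)
    show "subgroup (L \<inter> M) ?H"
      by (rule subgroup_incl[OF subgroups_Inter_pair[OF L M(1)] L]) simp
    \<comment> \<open>\<open>L \<inter> M\<close> contains \<open>T1\<close> and \<open>T2\<close>,
      so together with \<open>k\<close> it contains all generators of \<open>L\<close>.\<close>
    show "K = carrier ?H" if K: "subgroup K ?H" "L \<inter> M \<subseteq> K" "k \<in> K" for K
    proof
      show "K \<subseteq> carrier ?H" by (rule subgroup.subset[OF K(1)])
      have "gens \<subseteq> K" using K \<open>T1 \<union> T2 \<subseteq> L \<inter> M\<close> unfolding gens_def by blast
      then have "L \<subseteq> K" unfolding L_def using incl_subgroup[OF L K(1)] by (rule generate_subgroup_incl)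
      then show "carrier ?H \<subseteq> K" by simp
    qed
    show "x \<otimes>\<^bsub>?H\<^esub> f \<in> A \<inter> L \<longleftrightarrow> x \<in> A \<inter> L"
      if x: "x \<in> carrier ?H - L \<inter> M" and f: "f \<in> L \<inter> M" for x f
    proof -
      have "x \<in> carrier G" "x \<notin> translation_cut G f A" using x f closed L_carr by auto
      then have "x \<otimes> f \<in> A \<longleftrightarrow> x \<in> A" by (auto simp: translation_cut_def)
      then show ?thesis using x f subgroup.m_closed[OF L] by auto
    qed
    show "2 * card (translation_cut ?H k (A \<inter> L)) < card (L \<inter> M)" using cut_le card_F by simp
  qed (use finL k gens_L in \<open>auto simp: gens_def\<close>)
  moreover have "Suc d \<le> card (L \<inter> M \<inter> (A \<inter> L))"
    using T1 S1 \<open>T1 \<union> T2 \<subseteq> L \<inter> M\<close> finL by (subst T1(2)[symmetric], intro card_mono) auto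
  moreover have "Suc d \<le> card (L \<inter> M - A \<inter> L)"
    using T2 S2 \<open>T1 \<union> T2 \<subseteq> L \<inter> M\<close> finL by (subst T2(2)[symmetric], intro card_mono) auto
  ultimately show False using cut_le by linarith
qed

end

section \<open>Cluster points of the evaluation map\<close>

definition higson_product :: "('a, 'm) monoid_scheme \<Rightarrow> (('a \<Rightarrow> complex) \<Rightarrow> complex) topology" where
  "higson_product G = product_topology (\<lambda>_. euclidean) (higson_functions G)"

definition higson_eval :: "('a, 'm) monoid_scheme \<Rightarrow> 'a \<Rightarrow> ('a \<Rightarrow> complex) \<Rightarrow> complex" where
  "higson_eval G x = (\<lambda>f\<in>higson_functions G. f x)"

text \<open>The limit points at infinity along \<open>Y\<close>. The parameter \<open>Y\<close>
  allows an infinite set of exceptional elements to be given limit points of its own.\<close>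

definition cluster_points ::
  "('a, 'm) monoid_scheme \<Rightarrow> 'a set \<Rightarrow> (('a \<Rightarrow> complex) \<Rightarrow> complex) set" where
  "cluster_points G Y =
     (\<Inter>F\<in>finitary_bornology G. higson_product G closure_of (higson_eval G ` (Y - F)))"

lemma topspace_higson_product: "topspace (higson_product G) = extensional (higson_functions G)"
  by (simp add: higson_product_def PiE_UNIV_domain extensional_def PiE_def)

lemma higson_eval_topspace: "higson_eval G x \<in> topspace (higson_product G)"
  by (simp add: topspace_higson_product higson_eval_def)

lemma empty_in_finitary_bornology [simp]: "{} \<in> finitary_bornology G"
  by (simp add: finitary_bornology_def)

lemma openin_higson_box:
  assumes "finite T" "T \<subseteq> higson_functions G"
  shows "openin (higson_product G)
    {q \<in> topspace (higson_product G). \<forall>t\<in>T. norm (q t - p t) < \<epsilon>}"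
proof -
  have "openin (higson_product G) {q \<in> topspace (higson_product G). q t \<in> ball (p t) \<epsilon>}"
    if "t \<in> T" for t
    by (rule openin_continuous_map_preimage[where Y = euclidean])
      (use that assms in \<open>auto simp: higson_product_def intro!: continuous_map_product_projection\<close>)
  then have "openin (higson_product G) (topspace (higson_product G) \<inter>
      (\<Inter>t\<in>T. {q \<in> topspace (higson_product G). q t \<in> ball (p t) \<epsilon>}))"
    using assms(1) by (cases "T = {}") (auto intro!: openin_Int openin_INT)
  also have "topspace (higson_product G) \<inter>
      (\<Inter>t\<in>T. {q \<in> topspace (higson_product G). q t \<in> ball (p t) \<epsilon>})
      = {q \<in> topspace (higson_product G). \<forall>t\<in>T. norm (q t - p t) < \<epsilon>}"
    by (auto simp: dist_norm norm_minus_commute)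
  finally show ?thesis .
qed

text \<open>Basic open sets constrain finitely many coordinates, so a single radius serves for all
  of them.\<close>

lemma higson_box_subset_open:
  assumes V: "openin (higson_product G) V" "p \<in> V"
  obtains T \<epsilon> where "finite T" "T \<subseteq> higson_functions G" "\<epsilon> > 0"
    "{q \<in> topspace (higson_product G). \<forall>t\<in>T. norm (q t - p t) < \<epsilon>} \<subseteq> V"
proof -
  obtain U where U: "finite {f \<in> higson_functions G. U f \<noteq> UNIV}"
      "\<And>f. f \<in> higson_functions G \<Longrightarrow> open (U f)" "p \<in> Pi\<^sub>E (higson_functions G) U"
      "Pi\<^sub>E (higson_functions G) U \<subseteq> V"
    using V unfolding higson_product_def openin_product_topology_alt by auto
  define T where "T = {f \<in> higson_functions G. U f \<noteq> UNIV}"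
  have "\<exists>e>0. ball (p t) e \<subseteq> U t" if "t \<in> T" for t
    using U(2)[of t] U(3) that unfolding T_def by (auto simp: open_contains_ball PiE_iff)
  then obtain e where e: "\<And>t. t \<in> T \<Longrightarrow> e t > 0 \<and> ball (p t) (e t) \<subseteq> U t" by metis
  \<comment> \<open>The extra element 1 keeps the minimum defined when no coordinate is
    constrained.\<close>
  define \<epsilon> where "\<epsilon> = Min (insert 1 (e ` T))"
  have finT: "finite T" using U(1) by (simp add: T_def)
  show thesis
  proof
    show "finite T" by (rule finT)
    show "T \<subseteq> higson_functions G" by (auto simp: T_def)
    show "\<epsilon> > 0" unfolding \<epsilon>_def using finT e by (subst Min_gr_iff) auto
    show "{q \<in> topspace (higson_product G). \<forall>t\<in>T. norm (q t - p t) < \<epsilon>} \<subseteq> V"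
    proof
      fix q assume "q \<in> {q \<in> topspace (higson_product G). \<forall>t\<in>T. norm (q t - p t) < \<epsilon>}"
      then have q: "q \<in> topspace (higson_product G)" "\<And>t. t \<in> T \<Longrightarrow> norm (q t - p t) < \<epsilon>"
        by simp_all
      have "q t \<in> U t" if t: "t \<in> T" for t
      proof -
        have "\<epsilon> \<le> e t" unfolding \<epsilon>_def using finT t by (intro Min_le) auto
        then have "q t \<in> ball (p t) (e t)" using q(2)[OF t] by (auto simp: dist_norm norm_minus_commute)
        then show ?thesis using e[OF t] by blast
      qed
      then have "q \<in> Pi\<^sub>E (higson_functions G) U"
        using q(1) by (auto simp: PiE_iff topspace_higson_product T_def)
      then show "q \<in> V" using U(4) by blast
    qed
  qed
qed

text \<open>The boxes form a neighbourhood base, so clustering becomes simultaneous approximation of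
  finitely many Higson functions. Translation invariance and the comparison with characters are
  checked in this form.\<close>

lemma cluster_points_iff:
  "p \<in> cluster_points G Y \<longleftrightarrow> p \<in> extensional (higson_functions G) \<and>
    (\<forall>T \<epsilon> F. finite T \<longrightarrow> T \<subseteq> higson_functions G \<longrightarrow> \<epsilon> > 0 \<longrightarrow> F \<in> finitary_bornology G \<longrightarrow>
      (\<exists>x\<in>Y - F. \<forall>t\<in>T. norm (t x - p t) < \<epsilon>))"
  (is "_ \<longleftrightarrow> ?R")
proof
  assume "p \<in> cluster_points G Y"
  then have p: "p \<in> higson_product G closure_of (higson_eval G ` (Y - F))"
    if "F \<in> finitary_bornology G" for F
    using that by (simp add: cluster_points_def)
  have ptop: "p \<in> topspace (higson_product G)"
    using p[OF empty_in_finitary_bornology] by (simp add: in_closure_of)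
  show ?R
  proof (intro conjI allI impI)
    show "p \<in> extensional (higson_functions G)" using ptop by (simp add: topspace_higson_product)
    fix T and \<epsilon> :: real and F
    assume T: "finite T" "T \<subseteq> higson_functions G" and e: "\<epsilon> > 0" and F: "F \<in> finitary_bornology G"
    have "p \<in> {q \<in> topspace (higson_product G). \<forall>t\<in>T. norm (q t - p t) < \<epsilon>}"
      using ptop e by simp
    then obtain y where y: "y \<in> higson_eval G ` (Y - F)"
        "y \<in> {q \<in> topspace (higson_product G). \<forall>t\<in>T. norm (q t - p t) < \<epsilon>}"
      using p[OF F, unfolded in_closure_of, THEN conjunct2, rule_format,
          OF conjI[OF _ openin_higson_box[OF T, of p \<epsilon>]]]
      by blast
    then obtain x where x: "x \<in> Y - F" "y = higson_eval G x" by (elim imageE)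
    have "norm (t x - p t) < \<epsilon>" if t: "t \<in> T" for t
    proof -
      have "norm (y t - p t) < \<epsilon>" using y(2) t by simp
      then show ?thesis using subsetD[OF T(2) t] by (simp add: x(2) higson_eval_def)
    qed
    then show "\<exists>x\<in>Y - F. \<forall>t\<in>T. norm (t x - p t) < \<epsilon>" using x(1) by (intro bexI) simp_all
  qed
next
  assume R: ?R
  show "p \<in> cluster_points G Y"
    unfolding cluster_points_def
  proof (rule INT_I)
    fix F assume F: "F \<in> finitary_bornology G"
    show "p \<in> higson_product G closure_of (higson_eval G ` (Y - F))"
      unfolding in_closure_of
    proof (intro conjI allI impI)
      show "p \<in> topspace (higson_product G)" using R by (simp add: topspace_higson_product)
      fix V assume V: "p \<in> V \<and> openin (higson_product G) V"
      obtain T \<epsilon> where T: "finite T" "T \<subseteq> higson_functions G" "\<epsilon> > 0"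
        "{q \<in> topspace (higson_product G). \<forall>t\<in>T. norm (q t - p t) < \<epsilon>} \<subseteq> V"
        by (rule higson_box_subset_open[OF conjunct2[OF V] conjunct1[OF V]])
      from R T(1-3) F have "\<exists>x\<in>Y - F. \<forall>t\<in>T. norm (t x - p t) < \<epsilon>" by simp
      then obtain x where x: "x \<in> Y - F" "\<forall>t\<in>T. norm (t x - p t) < \<epsilon>" by (elim bexE)
      have "norm (higson_eval G x t - p t) < \<epsilon>" if "t \<in> T" for t
        using x(2) that subsetD[OF T(2) that] by (simp add: higson_eval_def)
      then have "higson_eval G x \<in> V"
        using T(4) higson_eval_topspace[of G x] by blast
      then show "\<exists>y. y \<in> higson_eval G ` (Y - F) \<and> y \<in> V"
        by (intro exI[of _ "higson_eval G x"]) (use x(1) in simp)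
    qed
  qed
qed

lemma cluster_pointsD:
  assumes "p \<in> cluster_points G Y" "finite T" "T \<subseteq> higson_functions G" "\<epsilon> > 0"
    "F \<in> finitary_bornology G"
  obtains x where "x \<in> Y" "x \<notin> F" "\<And>t. t \<in> T \<Longrightarrow> norm (t x - p t) < \<epsilon>"
proof -
  have "\<exists>x\<in>Y - F. \<forall>t\<in>T. norm (t x - p t) < \<epsilon>"
    using assms unfolding cluster_points_iff by simp
  then show thesis using that by auto
qed

lemma cluster_points_mono: "Y \<subseteq> Z \<Longrightarrow> cluster_points G Y \<subseteq> cluster_points G Z"
  unfolding cluster_points_def by (intro INF_superset_mono closure_of_mono image_mono Diff_mono) auto

section \<open>Compactness and existence of cluster points\<close>

lemma closedin_cluster_points: "closedin (higson_product G) (cluster_points G Y)"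
  unfolding cluster_points_def by (intro closedin_INT closedin_closure_of) (use empty_in_finitary_bornology in blast)

text \<open>Tychonoff: each Higson function is bounded, so all evaluations lie in a product of
  closed discs.\<close>

lemma higson_eval_compact:
  obtains K where "compactin (higson_product G) K" "higson_eval G ` carrier G \<subseteq> K"
proof -
  have "\<exists>M. \<forall>x\<in>carrier G. norm (f x) \<le> M" if "f \<in> higson_functions G" for f
    using bounded_functionsE[OF higson_bounded[OF that]] by metis
  then obtain M where M: "\<And>f x. f \<in> higson_functions G \<Longrightarrow> x \<in> carrier G \<Longrightarrow> norm (f x) \<le> M f"
    by metis
  show thesis
  proof
    show "compactin (higson_product G) (\<Pi>\<^sub>E f\<in>higson_functions G. cball 0 (M f))"
      unfolding higson_product_def compactin_PiE by simp
    show "higson_eval G ` carrier G \<subseteq> (\<Pi>\<^sub>E f\<in>higson_functions G. cball 0 (M f))"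
      using M by (auto simp: higson_eval_def)
  qed
qed

lemma Hausdorff_higson_product: "Hausdorff_space (higson_product G)"
  by (simp add: higson_product_def Hausdorff_space_product_topology Hausdorff_space_euclidean)

lemma closure_of_eval_subset_compact:
  assumes "compactin (higson_product G) K" "higson_eval G ` carrier G \<subseteq> K" "Y \<subseteq> carrier G"
  shows "higson_product G closure_of (higson_eval G ` Y) \<subseteq> K"
  using assms compactin_imp_closedin[OF Hausdorff_higson_product assms(1)]
  by (intro closure_of_minimal) auto

lemma compactin_cluster_points:
  assumes "Y \<subseteq> carrier G"
  shows "compactin (higson_product G) (cluster_points G Y)"
proof -
  obtain K where K: "compactin (higson_product G) K" "higson_eval G ` carrier G \<subseteq> K"
    by (rule higson_eval_compact)
  have "cluster_points G Y \<subseteq> higson_product G closure_of (higson_eval G ` Y)"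
    unfolding cluster_points_def by (rule INF_lower2[of "{}"]) auto
  then have "cluster_points G Y \<subseteq> K" using closure_of_eval_subset_compact[OF K assms] by blast
  then show ?thesis using closed_compactin[OF K(1) _ closedin_cluster_points] by blast
qed

text \<open>Finite intersection property: finitely many finite sets do not exhaust \<open>Y\<close>,
  so finitely many of the closures share an evaluation.\<close>

lemma cluster_points_nonempty:
  assumes "Y \<subseteq> carrier G" "infinite Y"
  shows "cluster_points G Y \<noteq> {}"
proof -
  obtain K where K: "compactin (higson_product G) K" "higson_eval G ` carrier G \<subseteq> K"
    by (rule higson_eval_compact)
  let ?C = "\<lambda>F. higson_product G closure_of (higson_eval G ` (Y - F))"
  have "K \<inter> \<Inter>\<F> \<noteq> {}" if \<F>: "finite \<F>" "\<F> \<subseteq> ?C ` finitary_bornology G" for \<F>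
  proof -
    obtain B where B: "B \<subseteq> finitary_bornology G" "finite B" "\<F> = ?C ` B"
      using finite_subset_image[OF \<F>] by (elim exE conjE)
    have "finite F" if "F \<in> B" for F
      using subsetD[OF B(1) that] by (simp add: finitary_bornology_def)
    then have "finite (\<Union>B)" using B(2) by (intro finite_Union)
    then have "\<not> Y \<subseteq> \<Union>B" using assms(2) finite_subset by blast
    then obtain y where y: "y \<in> Y" "y \<notin> \<Union>B" by blast
    have "higson_eval G y \<in> ?C F" if "F \<in> B" for F
    proof -
      have "higson_eval G y \<in> higson_eval G ` (Y - F)" using y that by blast
      moreover have "higson_eval G ` (Y - F) \<subseteq> ?C F"
        by (rule closure_of_subset) (auto intro: higson_eval_topspace)
      ultimately show ?thesis by (rule subsetD[rotated])
    qed
    then have "higson_eval G y \<in> \<Inter>\<F>" unfolding B(3) by (rule INT_I)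
    moreover have "higson_eval G y \<in> K" using y(1) assms(1) K(2) by auto
    ultimately have "higson_eval G y \<in> K \<inter> \<Inter>\<F>" by (intro IntI)
    then show ?thesis by (metis emptyE)
  qed
  then have "K \<inter> \<Inter>(?C ` finitary_bornology G) \<noteq> {}"
    using K(1)[unfolded compactin_fip, THEN conjunct2, THEN spec,
        of "?C ` finitary_bornology G"] by simp
  then show ?thesis by (auto simp only: cluster_points_def)
qed

text \<open>The pairs of \<open>x\<close> and \<open>x k\<close> form an entourage, so a Higson
  function takes nearly equal values at both ends far out, and the limits along \<open>Y\<close> are
  also limits along \<open>Y k\<close>.\<close>

lemma (in group) cluster_points_right_mult:
  assumes p: "p \<in> cluster_points G Y" and Y: "Y \<subseteq> carrier G" and k: "k \<in> carrier G"
  shows "p \<in> cluster_points G ((\<lambda>x. x \<otimes> k) ` Y)"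
  unfolding cluster_points_iff
proof (intro conjI allI impI)
  show "p \<in> extensional (higson_functions G)" using p by (simp add: cluster_points_iff)
  fix T and \<epsilon> :: real and F
  assume T: "finite T" "T \<subseteq> higson_functions G" and e: "\<epsilon> > 0" and F: "F \<in> finitary_bornology G"
  have E: "basic_entourage G {k} \<in> finitary_coarse_structure G"
    unfolding finitary_coarse_structure_def using k by (auto simp: finitary_bornology_def)
  have "\<exists>K\<in>finitary_bornology G. \<forall>x y. (x, y) \<in> basic_entourage G {k} \<longrightarrow> x \<notin> K \<longrightarrow> y \<notin> K \<longrightarrow>
      norm (t x - t y) < \<epsilon> / 2" if "t \<in> T" for t
    using higson_functionsD[OF _ E, of t "\<epsilon> / 2"] T that e by (metis half_gt_zero subsetD)
  then obtain K where K: "\<And>t. t \<in> T \<Longrightarrow> K t \<in> finitary_bornology G"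
      "\<And>t x y. t \<in> T \<Longrightarrow> (x, y) \<in> basic_entourage G {k} \<Longrightarrow> x \<notin> K t \<Longrightarrow> y \<notin> K t \<Longrightarrow>
        norm (t x - t y) < \<epsilon> / 2"
    by metis
  define H where "H = F \<union> (\<Union>t\<in>T. K t)"
  have H: "H \<in> finitary_bornology G"
    using F K(1) T unfolding H_def finitary_bornology_def by auto
  \<comment> \<open>Both \<open>x\<close> and \<open>x k\<close> have to avoid the exceptional set
    \<open>H\<close>, so \<open>x\<close> has to avoid its translate by \<open>inv k\<close> as
    well.\<close>
  then have "H \<union> (\<lambda>x. x \<otimes> inv k) ` H \<in> finitary_bornology G"
    using k by (auto simp: finitary_bornology_def)
  then obtain x where x: "x \<in> Y" "x \<notin> H \<union> (\<lambda>x. x \<otimes> inv k) ` H"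
      "\<And>t. t \<in> T \<Longrightarrow> norm (t x - p t) < \<epsilon> / 2"
    using cluster_pointsD[OF p T, of "\<epsilon> / 2"] e by (metis half_gt_zero)
  have xc: "x \<in> carrier G" using x Y by blast
  have xk: "x \<otimes> k \<notin> H"
  proof
    assume "x \<otimes> k \<in> H"
    then have "(x \<otimes> k) \<otimes> inv k \<in> (\<lambda>x. x \<otimes> inv k) ` H" by blast
    then show False using x(2) xc k by (simp add: m_assoc)
  qed
  have ent: "(x, x \<otimes> k) \<in> basic_entourage G {k}"
    using xc k by (simp add: basic_entourage_def m_assoc[symmetric])
  have "norm (t (x \<otimes> k) - p t) < \<epsilon>" if t: "t \<in> T" for t
  proof -
    have "norm (t x - t (x \<otimes> k)) < \<epsilon> / 2"
      using K(2)[OF t ent] x(2) xk t unfolding H_def by blast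
    moreover have "norm (t (x \<otimes> k) - p t) \<le> norm (t x - p t) + norm (t x - t (x \<otimes> k))"
      using norm_triangle_ineq4[of "t x - p t" "t x - t (x \<otimes> k)"] by simp
    ultimately show ?thesis using x(3)[OF t] by linarith
  qed
  then show "\<exists>y\<in>(\<lambda>x. x \<otimes> k) ` Y - F. \<forall>t\<in>T. norm (t y - p t) < \<epsilon>"
    using x(1) xk unfolding H_def by blast
qed

section \<open>Connectedness of the set of cluster points\<close>

lemma cluster_point_meets_open:
  assumes "p \<in> cluster_points G Y" "openin (higson_product G) V" "p \<in> V"
    "F \<in> finitary_bornology G"
  obtains y where "y \<in> Y" "y \<notin> F" "higson_eval G y \<in> V"
proof -
  have "p \<in> higson_product G closure_of (higson_eval G ` (Y - F))"
    using assms by (auto simp: cluster_points_def)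
  then show ?thesis using assms that unfolding in_closure_of by blast
qed

text \<open>An infinite \<open>Y\<close> would have a cluster point of its own; this lies in
  \<open>V\<close> and forces some element of \<open>Y\<close> to be evaluated in
  \<open>V\<close>.\<close>

lemma finite_if_avoids_cluster_points:
  assumes "Y \<subseteq> carrier G" "openin (higson_product G) V" "cluster_points G (carrier G) \<subseteq> V"
    and "\<And>y. y \<in> Y \<Longrightarrow> higson_eval G y \<notin> V"
  shows "finite Y"
proof (rule ccontr)
  assume "infinite Y"
  then obtain p where p: "p \<in> cluster_points G Y" using cluster_points_nonempty[OF assms(1)] by blast
  then have "p \<in> V" using assms(3) cluster_points_mono[OF assms(1)] by blast
  then show False
    using cluster_point_meets_open[OF p assms(2) _ empty_in_finitary_bornology] assms(4) by metis
qed

text \<open>A cluster point of an infinite set of such \<open>x\<close> is also one of the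
  translates \<open>x k\<close>. Lying in \<open>U\<close> it contradicts that the translates are
  evaluated in \<open>V\<close>; lying in \<open>V\<close> it contradicts that the \<open>x\<close>
  are evaluated in \<open>U\<close>.\<close>

lemma (in group) finite_translation_between_separated:
  assumes k: "k \<in> carrier G" and U: "openin (higson_product G) U" and V: "openin (higson_product G) V"
    and UV: "disjnt U V" and cover: "cluster_points G (carrier G) \<subseteq> U \<union> V"
  shows "finite {x \<in> carrier G. higson_eval G x \<in> U \<and> higson_eval G (x \<otimes> k) \<in> V}"
proof (rule ccontr)
  let ?Y = "{x \<in> carrier G. higson_eval G x \<in> U \<and> higson_eval G (x \<otimes> k) \<in> V}"
  have Y: "?Y \<subseteq> carrier G" by blast
  assume "infinite ?Y"
  then obtain p where p: "p \<in> cluster_points G ?Y" using cluster_points_nonempty[OF Y] by blast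
  have "p \<in> U \<union> V" using p cluster_points_mono[OF Y] cover by blast
  then show False
  proof
    assume "p \<in> U"
    obtain y where "y \<in> (\<lambda>x. x \<otimes> k) ` ?Y" "higson_eval G y \<in> U"
      by (rule cluster_point_meets_open[OF cluster_points_right_mult[OF p Y k] U \<open>p \<in> U\<close>
            empty_in_finitary_bornology])
    then show False using UV by (auto simp: disjnt_iff)
  next
    assume "p \<in> V"
    obtain y where "y \<in> ?Y" "higson_eval G y \<in> V"
      by (rule cluster_point_meets_open[OF p V \<open>p \<in> V\<close> empty_in_finitary_bornology])
    then show False using UV by (auto simp: disjnt_iff)
  qed
qed

lemma (in group) connectedin_cluster_points:
  assumes lf: "locally_finite_group G" and unc: "uncountable (carrier G)"
  shows "connectedin (higson_product G) (cluster_points G (carrier G))"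
proof -
  let ?P = "cluster_points G (carrier G)" and ?Z = "higson_product G"
  have False
    if E: "closedin ?Z E1" "closedin ?Z E2" "?P \<subseteq> E1 \<union> E2" "E1 \<inter> E2 \<inter> ?P = {}"
      "E1 \<inter> ?P \<noteq> {}" "E2 \<inter> ?P \<noteq> {}" for E1 E2
  proof -
    \<comment> \<open>Compactness in a Hausdorff space thickens the two relatively closed parts to
      disjoint open sets of the product, which can then be pulled back to the group.\<close>
    have "compactin ?Z (E1 \<inter> ?P)" "compactin ?Z (E2 \<inter> ?P)"
      using E compactin_cluster_points[of "carrier G" G] by (auto intro: closed_Int_compactin)
    moreover have "disjnt (E1 \<inter> ?P) (E2 \<inter> ?P)" using E(4) by (auto simp: disjnt_iff)
    ultimately obtain U V where U: "openin ?Z U" and V: "openin ?Z V"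
        and sub: "E1 \<inter> ?P \<subseteq> U" "E2 \<inter> ?P \<subseteq> V" and UV: "disjnt U V"
      using Hausdorff_space_compact_separation[OF Hausdorff_higson_product] by metis
    have cover: "?P \<subseteq> U \<union> V" using E(3) sub by blast
    define A where "A = {x \<in> carrier G. higson_eval G x \<in> U}"
    have rest: "finite {x \<in> carrier G. higson_eval G x \<notin> U \<union> V}"
      by (rule finite_if_avoids_cluster_points[OF _ openin_Un[OF U V] cover]) auto
    \<comment> \<open>A neighbourhood of a cluster point is visited outside every finite set, hence
      infinitely often.\<close>
    have inf: "infinite {x \<in> carrier G. higson_eval G x \<in> S}"
      if "openin ?Z S" "p \<in> ?P" "p \<in> S" for S p
    proof
      assume "finite {x \<in> carrier G. higson_eval G x \<in> S}"
      then have "{x \<in> carrier G. higson_eval G x \<in> S} \<in> finitary_bornology G"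
        by (auto simp: finitary_bornology_def)
      from cluster_point_meets_open[OF that(2,1,3) this] show False by blast
    qed
    have cut: "finite (translation_cut G k A)" if k: "k \<in> carrier G" for k
    proof -
      let ?R = "{x \<in> carrier G. higson_eval G x \<notin> U \<union> V}"
      \<comment> \<open>An edge cut by \<open>A\<close> either runs between \<open>U\<close> and
        \<open>V\<close> or has an end in the finite set \<open>?R\<close>; the last term covers the
        edges whose head \<open>x k\<close> lies in \<open>?R\<close>.\<close>
      have "translation_cut G k A \<subseteq>
          {x \<in> carrier G. higson_eval G x \<in> U \<and> higson_eval G (x \<otimes> k) \<in> V} \<union>
          {x \<in> carrier G. higson_eval G x \<in> V \<and> higson_eval G (x \<otimes> k) \<in> U} \<union>
          ?R \<union> (\<lambda>x. x \<otimes> inv k) ` ?R"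
      proof
        fix x assume x: "x \<in> translation_cut G k A"
        then have xc: "x \<in> carrier G" by (simp add: translation_cut_def)
        show "x \<in> {x \<in> carrier G. higson_eval G x \<in> U \<and> higson_eval G (x \<otimes> k) \<in> V} \<union>
          {x \<in> carrier G. higson_eval G x \<in> V \<and> higson_eval G (x \<otimes> k) \<in> U} \<union>
          ?R \<union> (\<lambda>x. x \<otimes> inv k) ` ?R"
        proof (cases "x \<otimes> k \<in> ?R")
          case True
          moreover have "x = (x \<otimes> k) \<otimes> inv k" using xc k by (simp add: m_assoc)
          ultimately show ?thesis by blast
        next
          case False
          then show ?thesis using x xc k by (auto simp: translation_cut_def A_def)
        qed
      qed
      moreover have "disjnt V U" "?P \<subseteq> V \<union> U" using UV cover by (auto simp: disjnt_iff)
      ultimately show ?thesis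
        using finite_translation_between_separated[OF k U V UV cover]
          finite_translation_between_separated[OF k V U] rest
        by (metis (no_types, lifting) finite_UnI finite_imageI finite_subset)
    qed
    have "A \<subseteq> carrier G" by (auto simp: A_def)
    then have "finite A \<or> finite (carrier G - A)"
      using almost_invariant_finite_or_cofinite[OF lf unc _ cut] by blast
    moreover have "infinite A" unfolding A_def using E(5) sub inf[OF U] by blast
    moreover have "infinite (carrier G - A)"
    proof
      assume "finite (carrier G - A)"
      moreover have "{x \<in> carrier G. higson_eval G x \<in> V} \<subseteq> carrier G - A"
        using UV by (auto simp: A_def disjnt_iff)
      ultimately have "finite {x \<in> carrier G. higson_eval G x \<in> V}" by (rule rev_finite_subset)
      then show False using E(6) sub inf[OF V] by blast
    qed
    ultimately show False by blast
  qed
  then show ?thesis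
    using closedin_subset[OF closedin_cluster_points] unfolding connectedin_closedin by metis
qed

section \<open>Characters of the Higson algebra\<close>

text \<open>The characters of the Higson algebra that kill the ideal. Homogeneity is encoded by the
  values on constants together with multiplicativity, and extensionality makes them points of
  \<open>higson_product G\<close>.\<close>

definition characters_at_infinity ::
  "('a, 'm) monoid_scheme \<Rightarrow> (('a \<Rightarrow> complex) \<Rightarrow> complex) set" where
  "characters_at_infinity G = {\<psi> \<in> extensional (higson_functions G).
     (\<forall>c. \<psi> (\<lambda>x\<in>carrier G. c) = c) \<and>
     (\<forall>f\<in>higson_functions G. \<forall>g\<in>higson_functions G.
        \<psi> (\<lambda>x\<in>carrier G. f x + g x) = \<psi> f + \<psi> g \<and>
        \<psi> (\<lambda>x\<in>carrier G. f x * g x) = \<psi> f * \<psi> g) \<and>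
     (\<forall>f\<in>vanishing_functions G. \<psi> f = 0)}"

lemma characters_at_infinityD:
  assumes "\<psi> \<in> characters_at_infinity G"
  shows "\<psi> \<in> extensional (higson_functions G)"
    and "\<psi> (\<lambda>x\<in>carrier G. c) = c"
    and "f \<in> higson_functions G \<Longrightarrow> g \<in> higson_functions G \<Longrightarrow>
      \<psi> (\<lambda>x\<in>carrier G. f x + g x) = \<psi> f + \<psi> g"
    and "f \<in> higson_functions G \<Longrightarrow> g \<in> higson_functions G \<Longrightarrow>
      \<psi> (\<lambda>x\<in>carrier G. f x * g x) = \<psi> f * \<psi> g"
    and "f \<in> vanishing_functions G \<Longrightarrow> \<psi> f = 0"
  using assms unfolding characters_at_infinity_def by blast+

text \<open>Supplies complex conjugates and truncated reciprocals of Higson functions.\<close>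

lemma higson_compose_lipschitz:
  assumes f: "f \<in> higson_functions G" and L: "L > 0"
    and lip: "\<And>x y. norm (F x - F y) \<le> L * norm (x - y)"
  shows "(\<lambda>x\<in>carrier G. F (f x)) \<in> higson_functions G"
proof (rule higson_functionsI)
  obtain M where M: "\<And>x. x \<in> carrier G \<Longrightarrow> norm (f x) \<le> M"
    using bounded_functionsE[OF higson_bounded[OF f]] by metis
  have "norm (F (f x)) \<le> norm (F 0) + L * M" if "x \<in> carrier G" for x
  proof -
    have "norm (F (f x)) \<le> norm (F 0) + norm (F (f x) - F 0)"
      using norm_triangle_ineq[of "F 0" "F (f x) - F 0"] by simp
    also have "norm (F (f x) - F 0) \<le> L * norm (f x)" using lip[of "f x" 0] by simp
    also have "L * norm (f x) \<le> L * M" using M[OF that] L by simp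
    finally show ?thesis by simp
  qed
  then show "(\<lambda>x\<in>carrier G. F (f x)) \<in> bounded_functions G"
    by (intro bounded_functionsI[where M = "norm (F 0) + L * M"]) auto
next
  fix E and \<epsilon> :: real assume E: "E \<in> finitary_coarse_structure G" and "\<epsilon> > 0"
  then have "\<epsilon> / L > 0" using L by simp
  obtain K where K: "K \<in> finitary_bornology G"
    "\<And>x y. (x, y) \<in> E \<Longrightarrow> x \<notin> K \<Longrightarrow> y \<notin> K \<Longrightarrow> norm (f x - f y) < \<epsilon> / L"
    using higson_functionsD[OF f E \<open>\<epsilon> / L > 0\<close>] by metis
  have "norm (F (f x) - F (f y)) < \<epsilon>" if "(x, y) \<in> E" "x \<notin> K" "y \<notin> K" for x y
  proof -
    have "norm (F (f x) - F (f y)) \<le> L * norm (f x - f y)" by (rule lip)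
    also have "\<dots> < L * (\<epsilon> / L)" using K(2)[OF that] L by (intro mult_strict_left_mono)
    finally show ?thesis using L by simp
  qed
  then show "\<exists>K\<in>finitary_bornology G. \<forall>x y. (x, y) \<in> E \<longrightarrow> x \<notin> K \<longrightarrow> y \<notin> K \<longrightarrow>
      norm ((\<lambda>x\<in>carrier G. F (f x)) x - (\<lambda>x\<in>carrier G. F (f x)) y) < \<epsilon>"
    using finitary_entourage_subset[OF E] K(1) by (intro bexI[of _ K]) auto
qed

text \<open>Truncation at \<delta> keeps the reciprocal away from its pole, where it would fail to
  be Lipschitz.\<close>

lemma inverse_max_lipschitz:
  fixes \<delta> :: real
  assumes "\<delta> > 0"
  shows "norm (complex_of_real (1 / max (Re z) \<delta>) - complex_of_real (1 / max (Re w) \<delta>))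
    \<le> 1 / \<delta>\<^sup>2 * norm (z - w)"
proof -
  let ?a = "max (Re z) \<delta>" and ?b = "max (Re w) \<delta>"
  have pos: "?a > 0" "?b > 0" using assms by auto
  have "1 / ?a - 1 / ?b = (?b - ?a) / (?a * ?b)" using pos by (simp add: diff_divide_eq_iff field_simps)
  then have "\<bar>1 / ?a - 1 / ?b\<bar> = \<bar>?b - ?a\<bar> / (?a * ?b)"
    using pos by (simp add: abs_mult)
  also have "\<dots> \<le> \<bar>?b - ?a\<bar> / (\<delta> * \<delta>)"
    using assms by (intro divide_left_mono mult_mono) (auto intro: mult_pos_pos)
  also have "\<bar>?b - ?a\<bar> \<le> norm (z - w)"
    using abs_Re_le_cmod[of "z - w"] by (auto simp: max_def)
  finally show ?thesis
    unfolding of_real_diff[symmetric] norm_of_real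
    using assms by (simp add: power2_eq_square divide_right_mono)
qed

lemma continuous_map_complex_mult:
  fixes f g :: "'b \<Rightarrow> complex"
  shows "continuous_map Y euclidean f \<Longrightarrow> continuous_map Y euclidean g \<Longrightarrow>
    continuous_map Y euclidean (\<lambda>x. f x * g x)"
  by (simp add: continuous_map_atin tendsto_mult)

text \<open>The algebraic identities hold at evaluations and are closed conditions, so they pass to
  the closure. A vanishing function is small off a finite set, and \<open>p\<close> is approximated
  by evaluations off that set.\<close>

lemma cluster_points_subset_characters_at_infinity:
  "cluster_points G (carrier G) \<subseteq> characters_at_infinity G"
proof
  fix p assume p: "p \<in> cluster_points G (carrier G)"
  then have "p \<in> higson_product G closure_of (higson_eval G ` (carrier G - {}))"
    unfolding cluster_points_def by (rule INT_D) simp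
  then have closure: "p \<in> higson_product G closure_of (higson_eval G ` carrier G)" by simp
  have eq: "F p = H p"
    if "continuous_map (higson_product G) euclidean F" "continuous_map (higson_product G) euclidean H"
      "\<And>x. x \<in> carrier G \<Longrightarrow> F (higson_eval G x) = H (higson_eval G x)"
    for F H :: "(('a \<Rightarrow> complex) \<Rightarrow> complex) \<Rightarrow> complex"
    by (rule forall_in_closure_of_eq[OF closure Hausdorff_space_euclidean that(1,2)]) (use that(3) in auto)
  have proj: "continuous_map (higson_product G) euclidean (\<lambda>q. q f)"
    if "f \<in> higson_functions G" for f
    using that unfolding higson_product_def by (rule continuous_map_product_projection)
  have eval: "higson_eval G x f = f x" if "f \<in> higson_functions G" for f x
    using that by (simp add: higson_eval_def)
  have "p (\<lambda>x\<in>carrier G. c) = c" for c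
    by (rule eq[OF proj[OF higson_const]]) (simp_all add: eval[OF higson_const])
  moreover have "p (\<lambda>x\<in>carrier G. f x + g x) = p f + p g"
    if f: "f \<in> higson_functions G" and g: "g \<in> higson_functions G" for f g
    by (rule eq[OF proj[OF higson_add[OF f g]] continuous_map_add[OF proj[OF f] proj[OF g]]])
      (simp add: eval[OF higson_add[OF f g]] eval[OF f] eval[OF g])
  moreover have "p (\<lambda>x\<in>carrier G. f x * g x) = p f * p g"
    if f: "f \<in> higson_functions G" and g: "g \<in> higson_functions G" for f g
    by (rule eq[OF proj[OF higson_mult[OF f g]] continuous_map_complex_mult[OF proj[OF f] proj[OF g]]])
      (simp add: eval[OF higson_mult[OF f g]] eval[OF f] eval[OF g])
  moreover have "p f = 0" if f: "f \<in> vanishing_functions G" for f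
  proof (rule ccontr)
    assume "p f \<noteq> 0"
    then have e: "norm (p f) / 2 > 0" by simp
    obtain F where F: "F \<in> finitary_bornology G"
        "\<And>x. x \<in> carrier G - F \<Longrightarrow> norm (f x) < norm (p f) / 2"
      using vanishing_functionsD[OF f e] by metis
    obtain x where x: "x \<in> carrier G" "x \<notin> F" "\<And>t. t \<in> {f} \<Longrightarrow> norm (t x - p t) < norm (p f) / 2"
      by (rule cluster_pointsD[OF p _ _ e F(1), of "{f}"]) (use f vanishing_subset_higson in auto)
    have "norm (f x) < norm (p f) / 2" "norm (f x - p f) < norm (p f) / 2"
      using F(2)[of x] x by auto
    then show False using norm_triangle_ineq4[of "f x" "f x - p f"] by simp
  qed
  moreover have "p \<in> extensional (higson_functions G)" using p by (simp add: cluster_points_iff)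
  ultimately show "p \<in> characters_at_infinity G"
    unfolding characters_at_infinity_def by blast
qed

text \<open>If \<open>\<psi>\<close> were not a cluster point, then \<open>h = (\<Sum>t\<in>T. \<bar>t - \<psi> t\<bar>\<^sup>2)\<close>, which lies in the kernel of
  \<open>\<psi>\<close>, would be bounded away from 0 outside a finite set, hence invertible modulo the vanishing
  functions.\<close>

lemma characters_at_infinity_subset_cluster_points:
  "characters_at_infinity G \<subseteq> cluster_points G (carrier G)"
proof
  fix \<psi> assume "\<psi> \<in> characters_at_infinity G"
  note ext = characters_at_infinityD(1)[OF this] and const = characters_at_infinityD(2)[OF this]
    and add = characters_at_infinityD(3)[OF this] and mult = characters_at_infinityD(4)[OF this]
    and vanish = characters_at_infinityD(5)[OF this]
  show "\<psi> \<in> cluster_points G (carrier G)"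
    unfolding cluster_points_iff
  proof (intro conjI allI impI ext)
    fix T and \<epsilon> :: real and F
    assume T: "finite T" "T \<subseteq> higson_functions G" and e: "\<epsilon> > 0" and F: "F \<in> finitary_bornology G"
    define sq where "sq t x = (norm (t x - \<psi> t))\<^sup>2" for t :: "'a \<Rightarrow> complex" and x
    define h where "h = (\<lambda>x\<in>carrier G. complex_of_real (\<Sum>t\<in>T. sq t x))"
    have "(\<lambda>x\<in>carrier G. complex_of_real (\<Sum>t\<in>S. sq t x)) \<in> higson_functions G \<and>
        \<psi> (\<lambda>x\<in>carrier G. complex_of_real (\<Sum>t\<in>S. sq t x)) = 0"
      if "finite S" "S \<subseteq> higson_functions G" for S
      using that
    proof (induction S rule: finite_induct)
      case empty
      show ?case unfolding sum.empty of_real_0 using higson_const const by blast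
    next
      case (insert t S)
      let ?s = "\<lambda>x\<in>carrier G. complex_of_real (\<Sum>t\<in>S. sq t x)"
      \<comment> \<open>The function \<open>t - \<psi> t\<close> lies in the kernel, so its product
        with its conjugate, the squared modulus, does so as well.\<close>
      let ?d = "\<lambda>x\<in>carrier G. t x + (\<lambda>x\<in>carrier G. - \<psi> t) x"
      let ?c = "\<lambda>x\<in>carrier G. cnj (?d x)"
      let ?q = "\<lambda>x\<in>carrier G. ?d x * ?c x"
      have t: "t \<in> higson_functions G" using insert by simp
      have d: "?d \<in> higson_functions G" by (rule higson_add[OF t higson_const])
      have c: "?c \<in> higson_functions G"
        by (rule higson_compose_lipschitz[OF d, of 1]) (simp_all flip: complex_cnj_diff)
      have "\<psi> ?d = 0" using add[OF t higson_const] const by simp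
      then have q0: "\<psi> ?q = 0" using mult[OF d c] by simp
      have q: "?q \<in> higson_functions G" by (rule higson_mult[OF d c])
      have "S \<subseteq> higson_functions G" using insert.prems by simp
      note s = conjunct1[OF insert.IH[OF this]] conjunct2[OF insert.IH[OF this]]
      have eq: "(\<lambda>x\<in>carrier G. complex_of_real (\<Sum>t\<in>insert t S. sq t x))
          = (\<lambda>x\<in>carrier G. ?s x + ?q x)"
        using insert(1,2)
        by (intro restrict_ext) (simp add: sq_def complex_norm_square del: of_real_power)
      have "\<psi> (\<lambda>x\<in>carrier G. ?s x + ?q x) = 0" unfolding add[OF s(1) q] s(2) q0 by (rule add_0)
      with higson_add[OF s(1) q] show ?case unfolding eq by (rule conjI)
    qed
    then have h: "h \<in> higson_functions G" "\<psi> h = 0" using T unfolding h_def by blast+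
    show "\<exists>x\<in>carrier G - F. \<forall>t\<in>T. norm (t x - \<psi> t) < \<epsilon>"
    proof (rule ccontr)
      assume neg: "\<not> (\<exists>x\<in>carrier G - F. \<forall>t\<in>T. norm (t x - \<psi> t) < \<epsilon>)"
      \<comment> \<open>Under the negation, off \<open>F\<close> some \<open>t\<close> is at
        distance at least \<epsilon> from \<open>\<psi> t\<close>, so \<open>h\<close> is at least
        \<epsilon> squared there and the truncated reciprocal is the true one.\<close>
      let ?g = "\<lambda>x\<in>carrier G. complex_of_real (1 / max (Re (h x)) (\<epsilon>\<^sup>2))"
      have g: "?g \<in> higson_functions G"
        by (rule higson_compose_lipschitz[OF h(1) _ inverse_max_lipschitz]) (use e in auto)
      have gh: "(\<lambda>x\<in>carrier G. ?g x * h x) \<in> higson_functions G"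
          "\<psi> (\<lambda>x\<in>carrier G. ?g x * h x) = 0"
        by (rule higson_mult[OF g h(1)]) (unfold mult[OF g h(1)] h(2), rule mult_zero_right)
      \<comment> \<open>\<open>g h - 1\<close> is zero off \<open>F\<close>, so \<psi> should kill
        it, but \<open>\<psi> h = 0\<close> gives it the value -1.\<close>
      let ?r = "\<lambda>x\<in>carrier G. (\<lambda>x\<in>carrier G. ?g x * h x) x + (\<lambda>x\<in>carrier G. - 1) x"
      have r0: "?r x = 0" if x: "x \<in> carrier G - F" for x
      proof -
        obtain t where t: "t \<in> T" "\<not> norm (t x - \<psi> t) < \<epsilon>" using neg x by blast
        then have "\<epsilon>\<^sup>2 \<le> sq t x" using e unfolding sq_def by (intro power_mono) auto
        also have "\<dots> \<le> (\<Sum>t\<in>T. sq t x)" using t(1) T(1) by (intro member_le_sum) (auto simp: sq_def)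
        finally have le: "\<epsilon>\<^sup>2 \<le> (\<Sum>t\<in>T. sq t x)" .
        have "\<epsilon>\<^sup>2 > 0" using e by simp
        with le have pos: "(\<Sum>t\<in>T. sq t x) > 0" by linarith
        have "?g x * h x = complex_of_real (1 / (\<Sum>t\<in>T. sq t x) * (\<Sum>t\<in>T. sq t x))"
          using x le by (simp only: h_def restrict_apply Diff_iff if_True Re_complex_of_real
              max_absorb1 of_real_mult)
        also have "\<dots> = 1" using pos by simp
        finally have gh1: "?g x * h x = 1" .
        have "?r x = ?g x * h x + - 1" using x by (simp only: restrict_apply Diff_iff if_True)
        then show ?thesis unfolding gh1 by simp
      qed
      have "?r \<in> vanishing_functions G"
        unfolding vanishing_functions_def
      proof (intro CollectI conjI allI impI)
        show "?r \<in> bounded_functions G"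
          by (rule higson_bounded[OF higson_add[OF gh(1) higson_const]])
        show "\<exists>F\<in>finitary_bornology G. \<forall>x\<in>carrier G - F. norm (?r x) < \<delta>"
          if "\<delta> > 0" for \<delta> :: real
        proof (intro bexI[OF _ F] ballI)
          fix x assume x: "x \<in> carrier G - F"
          show "norm (?r x) < \<delta>" unfolding r0[OF x] using that by simp
        qed
      qed
      then have "\<psi> ?r = 0" by (rule vanish)
      moreover have "\<psi> ?r = - 1" unfolding add[OF gh(1) higson_const] gh(2) const by simp
      ultimately show False by simp
    qed
  qed
qed

section \<open>From the Higson algebra to the quotient and the corona\<close>

lemma higson_algebra_simps:
  "carrier (higson_algebra G) = higson_functions G"
  "mult (higson_algebra G) = (\<lambda>f g. \<lambda>x\<in>carrier G. f x * g x)"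
  "one (higson_algebra G) = (\<lambda>x\<in>carrier G. 1)"
  "add (higson_algebra G) = (\<lambda>f g. \<lambda>x\<in>carrier G. f x + g x)"
  "smult (higson_algebra G) = (\<lambda>c f. \<lambda>x\<in>carrier G. c * f x)"
  by (simp_all add: higson_algebra_def)

abbreviation higson_quotient where
  "higson_quotient G \<equiv> quotient_algebra (higson_algebra G) (vanishing_functions G)"

abbreviation higson_coset where
  "higson_coset G f \<equiv> vanishing_functions G +>\<^bsub>higson_algebra G\<^esub> f"

lemma carrier_higson_quotient:
  "carrier (higson_quotient G) = higson_coset G ` higson_functions G"
  by (auto simp: A_RCOSETS_def' higson_algebra_simps)

lemma higson_coset_ops:
  assumes "f \<in> higson_functions G" "g \<in> higson_functions G"
  shows "higson_coset G f \<otimes>\<^bsub>higson_quotient G\<^esub> higson_coset G g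
      = higson_coset G (\<lambda>x\<in>carrier G. f x * g x)"
    "higson_coset G f \<oplus>\<^bsub>higson_quotient G\<^esub> higson_coset G g
      = higson_coset G (\<lambda>x\<in>carrier G. f x + g x)"
    "c \<odot>\<^bsub>higson_quotient G\<^esub> higson_coset G f = higson_coset G (\<lambda>x\<in>carrier G. c * f x)"
proof -
  interpret I: ideal "vanishing_functions G" "higson_algebra G" by (rule ideal_vanishing_functions)
  show "higson_coset G f \<otimes>\<^bsub>higson_quotient G\<^esub> higson_coset G g
      = higson_coset G (\<lambda>x\<in>carrier G. f x * g x)"
    using I.rcoset_mult_add[of f g] assms by (simp add: higson_algebra_simps)
  show "higson_coset G f \<oplus>\<^bsub>higson_quotient G\<^esub> higson_coset G g
      = higson_coset G (\<lambda>x\<in>carrier G. f x + g x)"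
    using I.a_rcos_sum[of f g] assms by (simp add: higson_algebra_simps)
  show "c \<odot>\<^bsub>higson_quotient G\<^esub> higson_coset G f = higson_coset G (\<lambda>x\<in>carrier G. c * f x)"
    using quotient_algebra_smult[OF algebra_higson_algebra ideal_vanishing_functions, of c f G] assms
    by (simp add: higson_algebra_simps ring_of_type_algebra_def)
qed

text \<open>The universal property of the quotient: composition with the coset map turns its
  characters into the characters that kill the ideal.\<close>

lemma characters_higson_quotient_iff:
  "\<phi> \<in> characters (higson_quotient G) \<longleftrightarrow>
    \<phi> \<in> extensional (carrier (higson_quotient G)) \<and>
    (\<lambda>f\<in>higson_functions G. \<phi> (higson_coset G f)) \<in> characters_at_infinity G"
  (is "?L \<longleftrightarrow> ?R")
proof -
  let ?\<psi> = "\<lambda>f\<in>higson_functions G. \<phi> (higson_coset G f)"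
  let ?Q = "higson_quotient G"
  interpret I: ideal "vanishing_functions G" "higson_algebra G" by (rule ideal_vanishing_functions)
  have one: "one ?Q = higson_coset G (\<lambda>x\<in>carrier G. 1)" by (simp add: higson_algebra_simps)
  \<comment> \<open>Scaling is multiplication by a constant function, and a constant is a multiple
    of the unit; these two identities exchange homogeneity for the values on constants.\<close>
  have smult_const: "(\<lambda>x\<in>carrier G. c * f x) = (\<lambda>x\<in>carrier G. (\<lambda>x\<in>carrier G. c) x * f x)"
    for c :: complex and f by (rule restrict_ext) simp
  have const_smult: "(\<lambda>x\<in>carrier G. c) = (\<lambda>x\<in>carrier G. c * (\<lambda>x\<in>carrier G. 1) x)"
    for c :: complex by (rule restrict_ext) simp
  show ?thesis
  proof
    assume ?L
    then have ext: "\<phi> \<in> extensional (carrier ?Q)"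
      and hom: "\<phi> \<in> ring_hom ?Q (ring_of_type_algebra :: complex ring)"
      and sm: "\<And>c S. S \<in> carrier ?Q \<Longrightarrow> \<phi> (c \<odot>\<^bsub>?Q\<^esub> S) = c * \<phi> S"
      unfolding characters_def by blast+
    have Qc: "higson_coset G f \<in> carrier ?Q" if "f \<in> higson_functions G" for f
      unfolding carrier_higson_quotient using that by (rule imageI)
    have \<phi>_one: "\<phi> (higson_coset G (\<lambda>x\<in>carrier G. 1)) = 1"
      using ring_hom_one[OF hom] unfolding one by (simp add: ring_of_type_algebra_def)
    have \<phi>_smult: "\<phi> (higson_coset G (\<lambda>x\<in>carrier G. c * f x)) = c * \<phi> (higson_coset G f)"
      if "f \<in> higson_functions G" for c f
      using sm[OF Qc[OF that], of c] unfolding higson_coset_ops(3)[OF that that] .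
    have const: "\<phi> (higson_coset G (\<lambda>x\<in>carrier G. c)) = c" for c
      using \<phi>_smult[OF higson_const, of c 1] \<phi>_one unfolding const_smult[symmetric] by simp
    have add: "\<phi> (higson_coset G (\<lambda>x\<in>carrier G. f x + g x))
        = \<phi> (higson_coset G f) + \<phi> (higson_coset G g)"
      if "f \<in> higson_functions G" "g \<in> higson_functions G" for f g
      using ring_hom_add[OF hom Qc[OF that(1)] Qc[OF that(2)]] unfolding higson_coset_ops(2)[OF that]
      by (simp add: ring_of_type_algebra_def)
    have mult: "\<phi> (higson_coset G (\<lambda>x\<in>carrier G. f x * g x))
        = \<phi> (higson_coset G f) * \<phi> (higson_coset G g)"
      if "f \<in> higson_functions G" "g \<in> higson_functions G" for f g
      using ring_hom_mult[OF hom Qc[OF that(1)] Qc[OF that(2)]] unfolding higson_coset_ops(1)[OF that]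
      by (simp add: ring_of_type_algebra_def)
    have vanish: "\<phi> (higson_coset G f) = 0" if "f \<in> vanishing_functions G" for f
    proof -
      \<comment> \<open>Both cosets equal the ideal itself.\<close>
      have "higson_coset G f = higson_coset G (\<lambda>x\<in>carrier G. 0)"
        unfolding I.a_rcos_const[OF that] I.a_rcos_const[OF vanishing_zero] ..
      then show ?thesis using const[of 0] by (rule trans[OF arg_cong[where f = \<phi>]])
    qed
    have "?\<psi> \<in> characters_at_infinity G"
      unfolding characters_at_infinity_def
    proof (intro CollectI conjI allI ballI)
      fix f g assume f: "f \<in> higson_functions G" and g: "g \<in> higson_functions G"
      show "?\<psi> (\<lambda>x\<in>carrier G. f x + g x) = ?\<psi> f + ?\<psi> g"
        unfolding restrict_apply'[OF f] restrict_apply'[OF g] restrict_apply'[OF higson_add[OF f g]]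
        by (rule add[OF f g])
      show "?\<psi> (\<lambda>x\<in>carrier G. f x * g x) = ?\<psi> f * ?\<psi> g"
        unfolding restrict_apply'[OF f] restrict_apply'[OF g] restrict_apply'[OF higson_mult[OF f g]]
        by (rule mult[OF f g])
    next
      fix f assume f: "f \<in> vanishing_functions G"
      show "?\<psi> f = 0"
        unfolding restrict_apply'[OF subsetD[OF vanishing_subset_higson f]] by (rule vanish[OF f])
    next
      show "?\<psi> (\<lambda>x\<in>carrier G. c) = c" for c
        unfolding restrict_apply'[OF higson_const] by (rule const)
    qed (rule restrict_extensional)
    then show ?R by (rule conjI[OF ext])
  next
    assume R: ?R
    then have \<psi>: "?\<psi> \<in> characters_at_infinity G" by (rule conjunct2)
    have const: "\<phi> (higson_coset G (\<lambda>x\<in>carrier G. c)) = c" for c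
      by (rule characters_at_infinityD(2)[OF \<psi>, unfolded restrict_apply'[OF higson_const]])
    have add: "\<phi> (higson_coset G (\<lambda>x\<in>carrier G. f x + g x))
        = \<phi> (higson_coset G f) + \<phi> (higson_coset G g)"
      if f: "f \<in> higson_functions G" and g: "g \<in> higson_functions G" for f g
      by (rule characters_at_infinityD(3)[OF \<psi> f g, unfolded restrict_apply'[OF f]
            restrict_apply'[OF g] restrict_apply'[OF higson_add[OF f g]]])
    have mult: "\<phi> (higson_coset G (\<lambda>x\<in>carrier G. f x * g x))
        = \<phi> (higson_coset G f) * \<phi> (higson_coset G g)"
      if f: "f \<in> higson_functions G" and g: "g \<in> higson_functions G" for f g
      by (rule characters_at_infinityD(4)[OF \<psi> f g, unfolded restrict_apply'[OF f]
            restrict_apply'[OF g] restrict_apply'[OF higson_mult[OF f g]]])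
    have smult: "\<phi> (higson_coset G (\<lambda>x\<in>carrier G. c * f x)) = c * \<phi> (higson_coset G f)"
      if "f \<in> higson_functions G" for c f
      unfolding smult_const mult[OF higson_const that] const ..
    have hom: "\<phi> \<in> ring_hom ?Q (ring_of_type_algebra :: complex ring)"
    proof (rule ring_hom_memI)
      fix S T assume "S \<in> carrier ?Q" "T \<in> carrier ?Q"
      then obtain f g where S: "S = higson_coset G f" and f: "f \<in> higson_functions G"
          and T: "T = higson_coset G g" and g: "g \<in> higson_functions G"
        unfolding carrier_higson_quotient by (elim imageE)
      show "\<phi> (S \<otimes>\<^bsub>?Q\<^esub> T) = \<phi> S \<otimes>\<^bsub>ring_of_type_algebra\<^esub> \<phi> T"
        unfolding S T higson_coset_ops(1)[OF f g] mult[OF f g]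
        by (simp add: ring_of_type_algebra_def)
      show "\<phi> (S \<oplus>\<^bsub>?Q\<^esub> T) = \<phi> S \<oplus>\<^bsub>ring_of_type_algebra\<^esub> \<phi> T"
        unfolding S T higson_coset_ops(2)[OF f g] add[OF f g]
        by (simp add: ring_of_type_algebra_def)
    next
      show "\<phi> \<one>\<^bsub>?Q\<^esub> = \<one>\<^bsub>ring_of_type_algebra\<^esub>"
        unfolding one const by (simp add: ring_of_type_algebra_def)
    qed (simp add: ring_of_type_algebra_def)
    have sm: "\<phi> (c \<odot>\<^bsub>?Q\<^esub> S) = c * \<phi> S" if S: "S \<in> carrier ?Q" for c S
    proof -
      obtain f where f: "S = higson_coset G f" "f \<in> higson_functions G"
        using S unfolding carrier_higson_quotient by (elim imageE)
      show ?thesis unfolding f(1) higson_coset_ops(3)[OF f(2) f(2)] by (rule smult[OF f(2)])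
    qed
    show ?L
      unfolding characters_def
      by (intro CollectI conjI allI ballI) (rule conjunct1[OF R], rule hom, rule sm)
  qed
qed

text \<open>Makes evaluation at a representative of a coset independent of the choice.\<close>

lemma characters_at_infinity_cong:
  assumes \<psi>: "\<psi> \<in> characters_at_infinity G" and f: "f \<in> higson_functions G"
    and g: "g \<in> higson_coset G f"
  shows "\<psi> g = \<psi> f"
proof -
  obtain i where i: "i \<in> vanishing_functions G" "g = (\<lambda>x\<in>carrier G. i x + f x)"
    using g by (auto simp: a_r_coset_def' higson_algebra_simps)
  have "\<psi> g = \<psi> i + \<psi> f"
    unfolding i(2)
    by (rule characters_at_infinityD(3)[OF \<psi> subsetD[OF vanishing_subset_higson i(1)] f])
  then show ?thesis using characters_at_infinityD(5)[OF \<psi> i(1)] by simp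
qed

text \<open>Evaluating each coset at a chosen representative makes every coordinate of
  \<open>r\<close> a coordinate projection, hence continuous. A continuous surjection suffices to
  transport connectedness to the corona.\<close>

lemma higson_corona_eq_image:
  obtains r where "continuous_map (higson_product G)
      (product_topology (\<lambda>_. euclidean) (carrier (higson_quotient G))) r"
    "r ` characters_at_infinity G = characters (higson_quotient G)"
proof -
  let ?Q = "higson_quotient G"
  interpret I: ideal "vanishing_functions G" "higson_algebra G" by (rule ideal_vanishing_functions)
  define rep where "rep S = (SOME f. f \<in> higson_functions G \<and> f \<in> S)"
    for S :: "('a \<Rightarrow> complex) set"
  define r where "r \<psi> = (\<lambda>S\<in>carrier ?Q. \<psi> (rep S))" for \<psi> :: "('a \<Rightarrow> complex) \<Rightarrow> complex"
  have rep: "rep (higson_coset G f) \<in> higson_functions G \<and> rep (higson_coset G f) \<in> higson_coset G f"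
    if "f \<in> higson_functions G" for f
    unfolding rep_def
    by (rule someI[of _ f]) (use that I.a_rcos_self[of f] in \<open>simp add: higson_algebra_simps\<close>)
  have r_coset: "r \<psi> (higson_coset G f) = \<psi> f"
    if "\<psi> \<in> characters_at_infinity G" "f \<in> higson_functions G" for \<psi> f
    using characters_at_infinity_cong[OF that conjunct2[OF rep[OF that(2)]]] that(2)
    unfolding r_def carrier_higson_quotient by simp
  show thesis
  proof
    show "continuous_map (higson_product G) (product_topology (\<lambda>_. euclidean) (carrier ?Q)) r"
      unfolding continuous_map_componentwise
    proof (intro conjI ballI)
      show "r ` topspace (higson_product G) \<subseteq> extensional (carrier ?Q)" by (auto simp: r_def)
      fix S assume S: "S \<in> carrier ?Q"
      then have "rep S \<in> higson_functions G"
        unfolding carrier_higson_quotient using rep by blast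
      then have "continuous_map (higson_product G) euclidean (\<lambda>\<psi>. \<psi> (rep S))"
        unfolding higson_product_def by (rule continuous_map_product_projection)
      then show "continuous_map (higson_product G) euclidean (\<lambda>\<psi>. r \<psi> S)"
        using S by (simp add: r_def del: quotient_algebra_simps)
    qed
    have "r \<psi> \<in> characters ?Q" if \<psi>: "\<psi> \<in> characters_at_infinity G" for \<psi>
    proof -
      have "(\<lambda>f\<in>higson_functions G. r \<psi> (higson_coset G f)) = \<psi>"
        using \<psi> by (auto simp: characters_at_infinity_def extensional_def fun_eq_iff r_coset[OF \<psi>])
      moreover have "r \<psi> \<in> extensional (carrier ?Q)" by (simp add: r_def del: quotient_algebra_simps)
      ultimately show ?thesis using \<psi> unfolding characters_higson_quotient_iff by metis
    qed
    moreover have "\<phi> \<in> r ` characters_at_infinity G" if \<phi>: "\<phi> \<in> characters ?Q" for \<phi>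
    proof -
      let ?\<psi> = "\<lambda>f\<in>higson_functions G. \<phi> (higson_coset G f)"
      have \<psi>: "?\<psi> \<in> characters_at_infinity G" and ext: "\<phi> \<in> extensional (carrier ?Q)"
        using \<phi> unfolding characters_higson_quotient_iff by blast+
      have "r ?\<psi> = \<phi>"
      proof (rule extensionalityI[OF _ ext])
        show "r ?\<psi> \<in> extensional (carrier ?Q)" by (simp add: r_def del: quotient_algebra_simps)
        fix S assume "S \<in> carrier ?Q"
        then obtain f where f: "S = higson_coset G f" "f \<in> higson_functions G"
          unfolding carrier_higson_quotient by (elim imageE)
        show "r ?\<psi> S = \<phi> S" unfolding f(1) r_coset[OF \<psi> f(2)] using f(2) by simp
      qed
      then show ?thesis using \<psi> by (metis imageI)
    qed
    ultimately show "r ` characters_at_infinity G = characters ?Q" by blast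
  qed
qed

section \<open>Connectedness and nonemptiness of the corona\<close>

theorem theorem4p1:
  fixes G :: "('a, 'm) monoid_scheme"
  assumes "group G"
    and "uncountable (carrier G)"
    and "locally_finite_group G"
  shows "card (coarse_ends G) = 1"
proof -
  interpret group G by (rule assms(1))
  let ?T = "product_topology (\<lambda>_. euclidean :: complex topology) (carrier (higson_quotient G))"
  let ?X = "characters (higson_quotient G)"
  have eq: "characters_at_infinity G = cluster_points G (carrier G)"
    using cluster_points_subset_characters_at_infinity characters_at_infinity_subset_cluster_points
    by (rule subset_antisym[rotated])
  obtain r where r: "continuous_map (higson_product G) ?T r" "r ` characters_at_infinity G = ?X"
    by (rule higson_corona_eq_image)
  have "connectedin ?T ?X"
    using connectedin_continuous_map_image[OF r(1) connectedin_cluster_points[OF assms(3,2)]]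
    unfolding r(2)[symmetric] eq .
  then have conn: "connected_space (higson_corona G)" and top: "topspace (higson_corona G) = ?X"
    unfolding higson_corona_def gelfand_spectrum_def connectedin_def
    by (simp_all only: topspace_subtopology_subset)
  \<comment> \<open>An infinite group has a cluster point, hence the quotient has a character; an
    empty corona would have no component at all.\<close>
  have "infinite (carrier G)" using assms(2) countable_finite by blast
  then have "?X \<noteq> {}"
    using cluster_points_nonempty[OF subset_refl, of G] r(2) eq by (metis image_is_empty)
  then have "higson_corona G \<noteq> trivial_topology" using top by auto
  \<comment> \<open>A nonempty connected space is its own unique component.\<close>
  then have "coarse_ends G = {topspace (higson_corona G)}"
    unfolding coarse_ends_def connected_components_of_eq_singleton using conn by simp
  then show ?thesis by simp
qed

end
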